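(* Assume that $\mathcal{P}$ is convex and $\sigma(L^1,L^\infty)$-compact, that $f$ is a normal convex integrand with $\mathbb{P}(f(\cdot,x)<\infty\ \forall x\in\mathbb{R})=1$, that for every $P\in\mathcal{P}$ there exists $Y\in L^1$ such that $\tilde f(\cdot,Y,dP/d\mathbb{P})^+\in L^1$, and that $\mathcal{D}\neq\emptyset$. Then for every $\nu\in ba$ with Yosida–Hewitt decomposition $\nu=\nu_r+\nu_s$, $$\mathcal{J}_{\tilde f,\mathcal{P}}\left(\frac{d\nu_r}{d\mathbb{P}}\right)+\sup_{X\in\mathcal{D}}\nu_s(X)\ \leq\ (\mathcal{I}_{f,\mathcal{P}})^*(\nu)\ \leq\ \mathcal{J}_{\tilde f,\mathcal{P}}\left(\frac{d\nu_r}{d\mathbb{P}}\right)+\sup_{X\in\mathrm{dom}(\mathcal{I}_{f,\mathcal{P}})}\nu_s(X).$$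
   Context: $(\Omega,\mathcal{F},\mathbb{P})$ is a complete probability space, $L^p:=L^p(\mathbb{P})$, $E:=E_{\mathbb{P}}$. $\mathcal{P}$ is a (nonempty) set of probability measures $P\ll\mathbb{P}$, identified with $\{dP/d\mathbb{P}\}_{P\in\mathcal{P}}\subset L^1$. A normal convex integrand is a map $f:\Omega\times\mathbb{R}\to\mathbb{R}\cup\{+\infty\}$ that is $\mathcal{F}\otimes\mathcal{B}(\mathbb{R})$-measurable and such that $x\mapsto f(\omega,x)$ is a lower semicontinuous proper convex function for a.e. $\omega$. For such $f$, define $\tilde f(\omega,y,z):=\sup_{x\in\mathbb{R}}(xy-zf(\omega,x))$ for $\omega\in\Omega$, $y\in\mathbb{R}$, $z\geq0$. Define $\mathcal{I}_{f,\mathcal{P}}(X):=\sup_{P\in\mathcal{P}}E_P[f(\cdot,X)]$ for $X\in L^\infty$; $\mathrm{dom}(\mathcal{I}_{f,\mathcal{P}}):=\{X\in L^\infty:\mathcal{I}_{f,\mathcal{P}}(X)<\infty\}$; $\mathcal{J}_{\tilde f,\mathcal{P}}(Y):=\inf_{P\in\mathcal{P}}E[\tilde f(\cdot,Y,dP/d\mathbb{P})]$ for $Y\in L^1$; and $\mathcal{D}:=\{X\in L^\infty:\{f(\cdot,X)^+dP/d\mathbb{P}\}_{P\in\mathcal{P}}\text{ is uniformly integrable}\}$. $ba=ba(\Omega,\mathcal{F},\mathbb{P})$ is the space of bounded finitely additive signed measures on $\mathcal{F}$ vanishing on $\mathbb{P}$-null sets, identified with $(L^\infty)^*$ via $\nu(X):=\int_\Omega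 X\,d\nu$. The conjugate is $(\mathcal{I}_{f,\mathcal{P}})^*(\nu):=\sup_{X\in L^\infty}(\nu(X)-\mathcal{I}_{f,\mathcal{P}}(X))$, $\nu\in ba$. The Yosida–Hewitt decomposition $\nu=\nu_r+\nu_s$ is the unique decomposition with $\nu_r$ $\sigma$-additive and $\nu_s$ purely finitely additive (every $\sigma$-additive $\mu\in ba$ with $0\leq\mu\leq|\nu_s|$ is $0$). *)

theory Defs
  imports "HOL-Probability.Probability"
begin

text \<open>
  Elements of $L^1$ and $L^\infty$ are represented by functions rather than by classes of
  almost everywhere equal functions.
\<close>

definition L1 :: "'a measure \<Rightarrow> ('a \<Rightarrow> real) set" where
  "L1 M = {Y. integrable M Y}"

definition Linf :: "'a measure \<Rightarrow> ('a \<Rightarrow> real) set" where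
  "Linf M = {X \<in> borel_measurable M. \<exists>C. AE \<omega> in M. \<bar>X \<omega>\<bar> \<le> C}"

text \<open>
  The topology $\sigma(L^1,L^\infty)$, as the coarsest one that makes every
  $Y \mapsto E[XY]$ with $X \in L^\infty$ continuous. Its open sets are closed under almost
  everywhere equality, so a set of representatives is compact iff the set of their classes is.
\<close>

definition weak_L1 :: "'a measure \<Rightarrow> ('a \<Rightarrow> real) topology" where
  "weak_L1 M =
     pullback_topology (L1 M) (\<lambda>Y. \<lambda>X\<in>Linf M. LINT \<omega>|M. X \<omega> * Y \<omega>)
       (product_topology (\<lambda>_. euclideanreal) (Linf M))"

text \<open>
  Expectation of an extended real valued function; it is $+\infty$ when both the positive and the
  negative part have infinite integral, since \<^term>\<open>\<infinity> - \<infinity> = (\<infinity>::ereal)\<close>.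
\<close>

definition ext_expectation :: "'a measure \<Rightarrow> ('a \<Rightarrow> ereal) \<Rightarrow> ereal" where
  "ext_expectation M g =
     enn2ereal (\<integral>\<^sup>+\<omega>. e2ennreal (max 0 (g \<omega>)) \<partial>M) - enn2ereal (\<integral>\<^sup>+\<omega>. e2ennreal (max 0 (- g \<omega>)) \<partial>M)"

definition ext_integrable :: "'a measure \<Rightarrow> ('a \<Rightarrow> ereal) \<Rightarrow> bool" where
  "ext_integrable M g \<longleftrightarrow> g \<in> borel_measurable M \<and> (\<integral>\<^sup>+\<omega>. e2ennreal \<bar>g \<omega>\<bar> \<partial>M) < \<infinity>"

definition uniformly_integrable :: "'a measure \<Rightarrow> ('a \<Rightarrow> ereal) set \<Rightarrow> bool" where
  "uniformly_integrable M H \<longleftrightarrow>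
     H \<subseteq> borel_measurable M \<and>
     ((\<lambda>c::real. SUP h\<in>H. \<integral>\<^sup>+\<omega>. e2ennreal \<bar>h \<omega>\<bar> * indicator {\<omega>. ereal c \<le> \<bar>h \<omega>\<bar>} \<omega> \<partial>M) \<longlongrightarrow> 0) at_top"

definition ac_prob_measures :: "'a measure \<Rightarrow> 'a measure set" where
  "ac_prob_measures M = {P. prob_space P \<and> sets P = sets M \<and> absolutely_continuous M P}"

definition convex_measures :: "'a measure \<Rightarrow> 'a measure set \<Rightarrow> bool" where
  "convex_measures M \<P> \<longleftrightarrow>
     (\<forall>P\<in>\<P>. \<forall>Q\<in>\<P>. \<forall>t\<in>{0..1}. \<exists>R\<in>\<P>. \<forall>A\<in>sets M.
        measure R A = t * measure P A + (1 - t) * measure Q A)"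

text \<open>\<^const>\<open>RN_deriv\<close> is \<^typ>\<open>ennreal\<close>-valued; for probability measures it is almost everywhere finite.\<close>

definition dens :: "'a measure \<Rightarrow> 'a measure \<Rightarrow> 'a \<Rightarrow> real" where
  "dens M P \<omega> = enn2real (RN_deriv M P \<omega>)"

definition lower_semicontinuous :: "(real \<Rightarrow> ereal) \<Rightarrow> bool" where
  "lower_semicontinuous g \<longleftrightarrow> (\<forall>x. g x \<le> Liminf (at x) g)"

definition proper :: "(real \<Rightarrow> ereal) \<Rightarrow> bool" where
  "proper g \<longleftrightarrow> (\<forall>x. g x \<noteq> -\<infinity>) \<and> (\<exists>x. g x < \<infinity>)"

definition ext_convex :: "(real \<Rightarrow> ereal) \<Rightarrow> bool" where
  "ext_convex g \<longleftrightarrow>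
     (\<forall>x y. \<forall>t\<in>{0<..<1::real}. g (t * x + (1 - t) * y) \<le> ereal t * g x + ereal (1 - t) * g y)"

definition normal_convex_integrand :: "'a measure \<Rightarrow> ('a \<Rightarrow> real \<Rightarrow> ereal) \<Rightarrow> bool" where
  "normal_convex_integrand M f \<longleftrightarrow>
     (\<forall>\<omega>\<in>space M. \<forall>x. f \<omega> x \<noteq> -\<infinity>) \<and>
     (\<lambda>(\<omega>, x). f \<omega> x) \<in> borel_measurable (M \<Otimes>\<^sub>M borel) \<and>
     (AE \<omega> in M. lower_semicontinuous (f \<omega>) \<and> proper (f \<omega>) \<and> ext_convex (f \<omega>))"

text \<open>For \<open>z = 0\<close> and \<^prop>\<open>f \<omega> x = \<infinity>\<close> the convention \<^term>\<open>0 * \<infinity> = (0::ereal)\<close> applies.\<close>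

definition ftilde :: "('a \<Rightarrow> real \<Rightarrow> ereal) \<Rightarrow> 'a \<Rightarrow> real \<Rightarrow> real \<Rightarrow> ereal" where
  "ftilde f \<omega> y z = (SUP x. ereal (x * y) - ereal z * f \<omega> x)"

definition I_fun :: "('a \<Rightarrow> real \<Rightarrow> ereal) \<Rightarrow> 'a measure set \<Rightarrow> ('a \<Rightarrow> real) \<Rightarrow> ereal" where
  "I_fun f \<P> X = (SUP P\<in>\<P>. ext_expectation P (\<lambda>\<omega>. f \<omega> (X \<omega>)))"

definition dom_I :: "'a measure \<Rightarrow> ('a \<Rightarrow> real \<Rightarrow> ereal) \<Rightarrow> 'a measure set \<Rightarrow> ('a \<Rightarrow> real) set" where
  "dom_I M f \<P> = {X \<in> Linf M. I_fun f \<P> X < \<infinity>}"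

definition J_fun :: "'a measure \<Rightarrow> ('a \<Rightarrow> real \<Rightarrow> ereal) \<Rightarrow> 'a measure set \<Rightarrow> ('a \<Rightarrow> real) \<Rightarrow> ereal" where
  "J_fun M f \<P> Y = (INF P\<in>\<P>. ext_expectation M (\<lambda>\<omega>. ftilde f \<omega> (Y \<omega>) (dens M P \<omega>)))"

definition UI_dom :: "'a measure \<Rightarrow> ('a \<Rightarrow> real \<Rightarrow> ereal) \<Rightarrow> 'a measure set \<Rightarrow> ('a \<Rightarrow> real) set" where
  "UI_dom M f \<P> =
     {X \<in> Linf M. uniformly_integrable M
        ((\<lambda>P. \<lambda>\<omega>. max 0 (f \<omega> (X \<omega>)) * ereal (dens M P \<omega>)) ` \<P>)}"

text \<open>Set functions are only relevant on \<^term>\<open>sets M\<close>.\<close>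

definition ba :: "'a measure \<Rightarrow> ('a set \<Rightarrow> real) set" where
  "ba M = {\<nu>. additive (sets M) \<nu> \<and> (\<exists>C. \<forall>A\<in>sets M. \<bar>\<nu> A\<bar> \<le> C) \<and> (\<forall>A\<in>null_sets M. \<nu> A = 0)}"

definition sigma_additive :: "'a measure \<Rightarrow> ('a set \<Rightarrow> real) \<Rightarrow> bool" where
  "sigma_additive M \<nu> \<longleftrightarrow>
     (\<forall>A::nat \<Rightarrow> 'a set. range A \<subseteq> sets M \<longrightarrow> disjoint_family A \<longrightarrow> (\<lambda>i. \<nu> (A i)) sums \<nu> (\<Union>i. A i))"

definition variation :: "'a measure \<Rightarrow> ('a set \<Rightarrow> real) \<Rightarrow> 'a set \<Rightarrow> real" where
  "variation M \<nu> A =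
     (SUP \<pi>\<in>{\<pi>. finite \<pi> \<and> \<pi> \<subseteq> sets M \<and> partition_on A \<pi>}. \<Sum>B\<in>\<pi>. \<bar>\<nu> B\<bar>)"

definition purely_finitely_additive :: "'a measure \<Rightarrow> ('a set \<Rightarrow> real) \<Rightarrow> bool" where
  "purely_finitely_additive M \<nu> \<longleftrightarrow>
     (\<forall>\<mu>\<in>ba M. sigma_additive M \<mu> \<longrightarrow> (\<forall>A\<in>sets M. 0 \<le> \<mu> A \<and> \<mu> A \<le> variation M \<nu> A) \<longrightarrow>
        (\<forall>A\<in>sets M. \<mu> A = 0))"

definition yosida_hewitt ::
  "'a measure \<Rightarrow> ('a set \<Rightarrow> real) \<Rightarrow> ('a set \<Rightarrow> real) \<Rightarrow> ('a set \<Rightarrow> real) \<Rightarrow> bool" where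
  "yosida_hewitt M \<nu> \<nu>r \<nu>s \<longleftrightarrow>
     \<nu>r \<in> ba M \<and> \<nu>s \<in> ba M \<and> (\<forall>A\<in>sets M. \<nu> A = \<nu>r A + \<nu>s A) \<and>
     sigma_additive M \<nu>r \<and> purely_finitely_additive M \<nu>s"

text \<open>
  The density of a \<open>\<sigma>\<close>-additive member of \<^const>\<open>ba\<close>, a signed measure, to which
  \<^const>\<open>RN_deriv\<close> does not apply.
\<close>

definition ba_density :: "'a measure \<Rightarrow> ('a set \<Rightarrow> real) \<Rightarrow> 'a \<Rightarrow> real" where
  "ba_density M \<nu> = (SOME Y. Y \<in> L1 M \<and> (\<forall>A\<in>sets M. \<nu> A = (LINT \<omega>:A|M. Y \<omega>)))"

text \<open>
  The integral of a function in $L^\infty$ with respect to a member of \<^const>\<open>ba\<close>: the limit of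
  the integrals of simple functions that converge to it in $L^\infty$.
\<close>

definition simple_ba_integral :: "'a measure \<Rightarrow> ('a set \<Rightarrow> real) \<Rightarrow> ('a \<Rightarrow> real) \<Rightarrow> real" where
  "simple_ba_integral M \<nu> s = (\<Sum>v\<in>s ` space M. v * \<nu> (s -` {v} \<inter> space M))"

definition Linf_tendsto :: "'a measure \<Rightarrow> (nat \<Rightarrow> 'a \<Rightarrow> real) \<Rightarrow> ('a \<Rightarrow> real) \<Rightarrow> bool" where
  "Linf_tendsto M s X \<longleftrightarrow> (\<forall>e>0. \<forall>\<^sub>F n in sequentially. AE \<omega> in M. \<bar>s n \<omega> - X \<omega>\<bar> \<le> e)"

definition has_ba_integral :: "'a measure \<Rightarrow> ('a set \<Rightarrow> real) \<Rightarrow> ('a \<Rightarrow> real) \<Rightarrow> real \<Rightarrow> bool" where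
  "has_ba_integral M \<nu> X r \<longleftrightarrow>
     (\<exists>s. (\<forall>n. simple_function M (s n)) \<and> Linf_tendsto M s X \<and>
          (\<lambda>n. simple_ba_integral M \<nu> (s n)) \<longlonglongrightarrow> r)"

definition ba_integral :: "'a measure \<Rightarrow> ('a set \<Rightarrow> real) \<Rightarrow> ('a \<Rightarrow> real) \<Rightarrow> real" where
  "ba_integral M \<nu> X = (THE r. has_ba_integral M \<nu> X r)"

lemma ba_empty: "\<nu> \<in> ba M \<Longrightarrow> \<nu> {} = 0"
  by (auto simp: ba_def)

lemma ba_finite_Union:
  assumes "\<nu> \<in> ba M" "finite S" "\<And>v. v \<in> S \<Longrightarrow> B v \<in> sets M" "disjoint_family_on B S"
  shows "\<nu> (\<Union>v\<in>S. B v) = (\<Sum>v\<in>S. \<nu> (B v))"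
  using assms(2-4)
proof (induction S)
  case empty
  then show ?case using assms(1) by (simp add: ba_empty)
next
  case (insert a S)
  have "B a \<inter> (\<Union>v\<in>S. B v) = {}"
    using insert.prems(2) insert.hyps by (fastforce simp: disjoint_family_on_def)
  moreover have "(\<Union>v\<in>S. B v) \<in> sets M" using insert by auto
  moreover have "B a \<in> sets M" using insert by auto
  moreover have "additive (sets M) \<nu>" using assms(1) by (simp add: ba_def)
  ultimately have "\<nu> (B a \<union> (\<Union>v\<in>S. B v)) = \<nu> (B a) + \<nu> (\<Union>v\<in>S. B v)"
    by (simp add: additive_def)
  moreover have "\<nu> (\<Union>v\<in>S. B v) = (\<Sum>v\<in>S. \<nu> (B v))"
    using insert by (auto simp: disjoint_family_on_def)
  ultimately show ?case using insert.hyps by simp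
qed

lemma simple_ba_integral_comp:
  assumes nu: "\<nu> \<in> ba M" and h: "simple_function M h"
  shows "simple_ba_integral M \<nu> (\<lambda>\<omega>. g (h \<omega>)) =
    (\<Sum>v\<in>h ` space M. g v * \<nu> (h -` {v} \<inter> space M))"
proof -
  have fin: "finite (h ` space M)" and ms: "\<And>v. v \<in> h ` space M \<Longrightarrow> h -` {v} \<inter> space M \<in> sets M"
    using h by (auto simp: simple_function_def)
  have "\<nu> ((\<lambda>\<omega>. g (h \<omega>)) -` {u} \<inter> space M) =
      (\<Sum>v\<in>{v \<in> h ` space M. g v = u}. \<nu> (h -` {v} \<inter> space M))" for u
  proof -
    have "(\<lambda>\<omega>. g (h \<omega>)) -` {u} \<inter> space M = (\<Union>v\<in>{v \<in> h ` space M. g v = u}. h -` {v} \<inter> space M)"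
      by auto
    then show ?thesis
      using ba_finite_Union[OF nu, of "{v \<in> h ` space M. g v = u}" "\<lambda>v. h -` {v} \<inter> space M"] fin ms
      by (auto simp: disjoint_family_on_def)
  qed
  then have "simple_ba_integral M \<nu> (\<lambda>\<omega>. g (h \<omega>)) =
     (\<Sum>u\<in>g ` h ` space M. \<Sum>v\<in>{v \<in> h ` space M. g v = u}. g v * \<nu> (h -` {v} \<inter> space M))"
    unfolding simple_ba_integral_def by (simp add: image_image sum_distrib_left)
  also have "\<dots> = (\<Sum>v\<in>h ` space M. g v * \<nu> (h -` {v} \<inter> space M))"
    using fin by (intro sum.group) auto
  finally show ?thesis .
qed

lemma ba_sum_abs_le:
  assumes nu: "\<nu> \<in> ba M" and C: "\<And>A. A \<in> sets M \<Longrightarrow> \<bar>\<nu> A\<bar> \<le> C"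
    and "finite S" "\<And>v. v \<in> S \<Longrightarrow> B v \<in> sets M" "disjoint_family_on B S"
  shows "(\<Sum>v\<in>S. \<bar>\<nu> (B v)\<bar>) \<le> 2 * C"
proof -
  let ?P = "{v \<in> S. \<nu> (B v) \<ge> 0}" and ?N = "{v \<in> S. \<not> \<nu> (B v) \<ge> 0}"
  have "(\<Sum>v\<in>S. \<bar>\<nu> (B v)\<bar>) = (\<Sum>v\<in>?P. \<bar>\<nu> (B v)\<bar>) + (\<Sum>v\<in>?N. \<bar>\<nu> (B v)\<bar>)"
    using assms(3) by (subst sum.union_disjoint[symmetric]) (auto intro!: sum.cong)
  also have "\<dots> = (\<Sum>v\<in>?P. \<nu> (B v)) - (\<Sum>v\<in>?N. \<nu> (B v))"
    by (simp add: sum_negf[symmetric])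
  also have "\<dots> = \<nu> (\<Union>v\<in>?P. B v) - \<nu> (\<Union>v\<in>?N. B v)"
    using assms(3-5) ba_finite_Union[OF nu, of ?P B] ba_finite_Union[OF nu, of ?N B]
    by (auto simp: disjoint_family_on_def)
  also have "\<dots> \<le> 2 * C"
  proof -
    have "(\<Union>v\<in>?P. B v) \<in> sets M" "(\<Union>v\<in>?N. B v) \<in> sets M" using assms(3,4) by auto
    from C[OF this(1)] C[OF this(2)] show ?thesis by linarith
  qed
  finally show ?thesis .
qed

lemma simple_ba_integral_diff_le:
  assumes nu: "\<nu> \<in> ba M" and C: "\<And>A. A \<in> sets M \<Longrightarrow> \<bar>\<nu> A\<bar> \<le> C"
    and s: "simple_function M s" and t: "simple_function M t"
    and e: "AE \<omega> in M. \<bar>s \<omega> - t \<omega>\<bar> \<le> e" "e \<ge> 0"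
  shows "\<bar>simple_ba_integral M \<nu> s - simple_ba_integral M \<nu> t\<bar> \<le> e * (2 * C)"
proof -
  define h where "h = (\<lambda>\<omega>. (s \<omega>, t \<omega>))"
  have h: "simple_function M h" unfolding h_def using s t by (rule simple_function_Pair)
  then have fin: "finite (h ` space M)"
    and ms: "\<And>v. v \<in> h ` space M \<Longrightarrow> h -` {v} \<inter> space M \<in> sets M"
    by (auto simp: simple_function_def)
  let ?B = "\<lambda>v. h -` {v} \<inter> space M"
  have "simple_ba_integral M \<nu> s = (\<Sum>v\<in>h ` space M. fst v * \<nu> (?B v))"
    "simple_ba_integral M \<nu> t = (\<Sum>v\<in>h ` space M. snd v * \<nu> (?B v))"
    using simple_ba_integral_comp[OF nu h, of fst] simple_ba_integral_comp[OF nu h, of snd]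
    by (simp_all add: h_def)
  then have "simple_ba_integral M \<nu> s - simple_ba_integral M \<nu> t =
      (\<Sum>v\<in>h ` space M. (fst v - snd v) * \<nu> (?B v))"
    by (simp add: sum_subtractf left_diff_distrib)
  also have "\<bar>\<dots>\<bar> \<le> (\<Sum>v\<in>h ` space M. \<bar>(fst v - snd v) * \<nu> (?B v)\<bar>)"
    by (rule sum_abs)
  also have "\<dots> \<le> (\<Sum>v\<in>h ` space M. e * \<bar>\<nu> (?B v)\<bar>)"
  proof (rule sum_mono)
    fix v assume v: "v \<in> h ` space M"
    show "\<bar>(fst v - snd v) * \<nu> (?B v)\<bar> \<le> e * \<bar>\<nu> (?B v)\<bar>"
    proof (cases "\<bar>fst v - snd v\<bar> \<le> e")
      case True
      then show ?thesis by (simp add: abs_mult mult_right_mono)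
    next
      case False
      have "AE \<omega> in M. \<omega> \<notin> ?B v" using e(1) by eventually_elim (use False in \<open>auto simp: h_def\<close>)
      then have "?B v \<in> null_sets M" using AE_iff_null_sets[OF ms[OF v]] by simp
      then show ?thesis using nu by (simp add: ba_def)
    qed
  qed
  also have "\<dots> = e * (\<Sum>v\<in>h ` space M. \<bar>\<nu> (?B v)\<bar>)" by (simp add: sum_distrib_left)
  also have "\<dots> \<le> e * (2 * C)"
  proof (rule mult_left_mono[OF _ e(2)])
    have "disjoint_family_on ?B (h ` space M)" by (auto simp: disjoint_family_on_def)
    then show "(\<Sum>v\<in>h ` space M. \<bar>\<nu> (?B v)\<bar>) \<le> 2 * C"
      by (intro ba_sum_abs_le[OF nu _ fin]) (simp_all add: C ms)
  qed
  finally show ?thesis .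
qed

lemma has_ba_integral_unique:
  assumes nu: "\<nu> \<in> ba M" and "has_ba_integral M \<nu> X r" "has_ba_integral M \<nu> X q"
  shows "r = q"
proof -
  from nu obtain C where C: "\<And>A. A \<in> sets M \<Longrightarrow> \<bar>\<nu> A\<bar> \<le> C" by (auto simp: ba_def)
  have C0: "C \<ge> 0" using C[of "{}"] by auto
  from assms obtain s t where s: "\<And>n. simple_function M (s n)" "Linf_tendsto M s X"
      "(\<lambda>n. simple_ba_integral M \<nu> (s n)) \<longlonglongrightarrow> r"
    and t: "\<And>n. simple_function M (t n)" "Linf_tendsto M t X"
      "(\<lambda>n. simple_ba_integral M \<nu> (t n)) \<longlonglongrightarrow> q"
    unfolding has_ba_integral_def by auto
  have lim: "(\<lambda>n. \<bar>simple_ba_integral M \<nu> (s n) - simple_ba_integral M \<nu> (t n)\<bar>) \<longlonglongrightarrow> \<bar>r - q\<bar>"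
    by (intro tendsto_intros s t)
  have le: "\<bar>r - q\<bar> \<le> (2 * e) * (2 * C)" if "e > 0" for e
  proof (rule tendsto_upperbound[OF lim])
    have "\<forall>\<^sub>F n in sequentially. AE \<omega> in M. \<bar>s n \<omega> - X \<omega>\<bar> \<le> e"
      "\<forall>\<^sub>F n in sequentially. AE \<omega> in M. \<bar>t n \<omega> - X \<omega>\<bar> \<le> e"
      using s(2) t(2) that by (auto simp: Linf_tendsto_def)
    then show "\<forall>\<^sub>F n in sequentially.
        \<bar>simple_ba_integral M \<nu> (s n) - simple_ba_integral M \<nu> (t n)\<bar> \<le> (2 * e) * (2 * C)"
    proof eventually_elim
      case (elim n)
      then have "AE \<omega> in M. \<bar>s n \<omega> - t n \<omega>\<bar> \<le> 2 * e" by eventually_elim auto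
      then show ?case using that by (intro simple_ba_integral_diff_le[OF nu C s(1) t(1)]) auto
    qed
  qed simp
  show ?thesis
  proof (rule ccontr)
    assume "r \<noteq> q"
    then have pos: "\<bar>r - q\<bar> > 0" by simp
    then have "\<bar>r - q\<bar> \<le> (2 * (\<bar>r - q\<bar> / (8 * (C + 1)))) * (2 * C)"
      using C0 by (intro le) auto
    also have "\<dots> = \<bar>r - q\<bar> * (C / (2 * (C + 1)))"
      using C0 by (simp add: field_simps)
    also have "\<dots> < \<bar>r - q\<bar> * 1"
      using pos C0 by (intro mult_strict_left_mono) (auto simp: field_simps)
    finally show False by simp
  qed
qed

lemma Linf_simple_approx:
  assumes "X \<in> Linf M"
  shows "\<exists>s. (\<forall>n. simple_function M (s n)) \<and> (\<forall>n. AE \<omega> in M. \<bar>s n \<omega> - X \<omega>\<bar> \<le> inverse (real (Suc n)))"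
proof -
  from assms obtain C where X: "X \<in> borel_measurable M" and C: "AE \<omega> in M. \<bar>X \<omega>\<bar> \<le> C"
    by (auto simp: Linf_def)
  define Z where "Z \<omega> = max (- \<bar>C\<bar>) (min \<bar>C\<bar> (X \<omega>))" for \<omega>
  have Z: "Z \<in> borel_measurable M" unfolding Z_def using X by measurable
  have Zb: "\<bar>Z \<omega>\<bar> \<le> \<bar>C\<bar>" for \<omega> by (auto simp: Z_def)
  define s where "s n \<omega> = real_of_int \<lfloor>real (Suc n) * Z \<omega>\<rfloor> / real (Suc n)" for n \<omega>
  have "simple_function M (s n)" for n
  proof (rule simple_function_borel_measurable)
    show "s n \<in> borel_measurable M" unfolding s_def using Z by measurable
    have "s n ` space M \<subseteq> (\<lambda>k. real_of_int k / real (Suc n)) `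
        {\<lfloor>- (real (Suc n) * \<bar>C\<bar>)\<rfloor>..\<lfloor>real (Suc n) * \<bar>C\<bar>\<rfloor>}"
    proof
      fix y assume "y \<in> s n ` space M"
      then obtain \<omega> where y: "y = s n \<omega>" by auto
      have "\<bar>real (Suc n) * Z \<omega>\<bar> \<le> real (Suc n) * \<bar>C\<bar>"
        unfolding abs_mult using Zb[of \<omega>] by (intro mult_mono) auto
      then have "\<lfloor>- (real (Suc n) * \<bar>C\<bar>)\<rfloor> \<le> \<lfloor>real (Suc n) * Z \<omega>\<rfloor>"
          "\<lfloor>real (Suc n) * Z \<omega>\<rfloor> \<le> \<lfloor>real (Suc n) * \<bar>C\<bar>\<rfloor>"
        by (intro floor_mono; linarith)+
      then show "y \<in> (\<lambda>k. real_of_int k / real (Suc n)) `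
        {\<lfloor>- (real (Suc n) * \<bar>C\<bar>)\<rfloor>..\<lfloor>real (Suc n) * \<bar>C\<bar>\<rfloor>}"
        unfolding y s_def by auto
    qed
    then show "finite (s n ` space M)" by (rule finite_subset) auto
  qed
  moreover have "AE \<omega> in M. \<bar>s n \<omega> - X \<omega>\<bar> \<le> inverse (real (Suc n))" for n
    using C
  proof eventually_elim
    case (elim \<omega>)
    then have ZX: "Z \<omega> = X \<omega>" by (auto simp: Z_def)
    have "\<bar>real_of_int \<lfloor>real (Suc n) * X \<omega>\<rfloor> - real (Suc n) * X \<omega>\<bar> \<le> 1" by linarith
    then have "\<bar>real_of_int \<lfloor>real (Suc n) * X \<omega>\<rfloor> - real (Suc n) * X \<omega>\<bar> / real (Suc n) \<le> 1 / real (Suc n)"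
      by (intro divide_right_mono) auto
    also have "\<bar>real_of_int \<lfloor>real (Suc n) * X \<omega>\<rfloor> - real (Suc n) * X \<omega>\<bar> / real (Suc n) = \<bar>s n \<omega> - X \<omega>\<bar>"
    proof -
      have "s n \<omega> - X \<omega> = (real_of_int \<lfloor>real (Suc n) * X \<omega>\<rfloor> - real (Suc n) * X \<omega>) / real (Suc n)"
        by (simp add: s_def ZX diff_divide_distrib del: of_nat_Suc)
      then show ?thesis by (simp add: abs_divide del: of_nat_Suc)
    qed
    finally show ?case by (simp add: inverse_eq_divide)
  qed
  ultimately show ?thesis by blast
qed

lemma has_ba_integral_exists:
  assumes nu: "\<nu> \<in> ba M" and X: "X \<in> Linf M"
  shows "\<exists>r. has_ba_integral M \<nu> X r"
proof -
  from nu obtain C where C: "\<And>A. A \<in> sets M \<Longrightarrow> \<bar>\<nu> A\<bar> \<le> C" by (auto simp: ba_def)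
  have C0: "C \<ge> 0" using C[of "{}"] by auto
  obtain s where s: "\<And>n. simple_function M (s n)"
    "\<And>n. AE \<omega> in M. \<bar>s n \<omega> - X \<omega>\<bar> \<le> inverse (real (Suc n))"
    using Linf_simple_approx[OF X] by blast
  have ap: "\<forall>\<^sub>F n in sequentially. AE \<omega> in M. \<bar>s n \<omega> - X \<omega>\<bar> \<le> e" if "e > 0" for e
  proof -
    have "\<forall>\<^sub>F n in sequentially. inverse (real (Suc n)) < e"
      using order_tendstoD(2)[OF LIMSEQ_inverse_real_of_nat that] .
    then show ?thesis
    proof eventually_elim
      case (elim n)
      show ?case using s(2)[of n] by (rule eventually_mono) (use elim in linarith)
    qed
  qed
  have "Cauchy (\<lambda>n. simple_ba_integral M \<nu> (s n))"
  proof (rule metric_CauchyI)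
    fix e :: real assume e: "e > 0"
    define d where "d = e / (8 * (C + 1))"
    have d: "d > 0" using e C0 by (simp add: d_def)
    from ap[OF d] obtain N where N: "\<And>n. n \<ge> N \<Longrightarrow> AE \<omega> in M. \<bar>s n \<omega> - X \<omega>\<bar> \<le> d"
      by (auto simp: eventually_sequentially)
    have "2 * d * (2 * C) = e * (C / (2 * (C + 1)))" using C0 by (simp add: d_def field_simps)
    moreover have "e * (C / (2 * (C + 1))) < e * 1"
      using e C0 by (intro mult_strict_left_mono) (auto simp: field_simps)
    ultimately have lt: "2 * d * (2 * C) < e" by simp
    show "\<exists>N. \<forall>m\<ge>N. \<forall>n\<ge>N. dist (simple_ba_integral M \<nu> (s m)) (simple_ba_integral M \<nu> (s n)) < e"
    proof (intro exI[of _ N] allI impI)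
      fix m n assume "N \<le> m" "N \<le> n"
      have "AE \<omega> in M. \<bar>s m \<omega> - s n \<omega>\<bar> \<le> 2 * d"
        using N[OF \<open>N \<le> m\<close>] N[OF \<open>N \<le> n\<close>] by eventually_elim auto
      then show "dist (simple_ba_integral M \<nu> (s m)) (simple_ba_integral M \<nu> (s n)) < e"
        using simple_ba_integral_diff_le[OF nu C s(1) s(1), of m n "2 * d"] d lt
        by (simp add: dist_real_def)
    qed
  qed
  then obtain r where "(\<lambda>n. simple_ba_integral M \<nu> (s n)) \<longlonglongrightarrow> r"
    by (auto simp: Cauchy_convergent_iff convergent_def)
  then show ?thesis using s(1) ap by (auto simp: has_ba_integral_def Linf_tendsto_def)
qed

lemma has_ba_integral_ba_integral:
  assumes "\<nu> \<in> ba M" "X \<in> Linf M"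
  shows "has_ba_integral M \<nu> X (ba_integral M \<nu> X)"
  using has_ba_integral_exists[OF assms] has_ba_integral_unique[OF assms(1)]
  unfolding ba_integral_def by (metis theI)

definition I_conj ::
  "'a measure \<Rightarrow> ('a \<Rightarrow> real \<Rightarrow> ereal) \<Rightarrow> 'a measure set \<Rightarrow> ('a set \<Rightarrow> real) \<Rightarrow> ereal" where
  "I_conj M f \<P> \<nu> = (SUP X\<in>Linf M. ereal (ba_integral M \<nu> X) - I_fun f \<P> X)"

end

theory Submission
  imports Defs
begin

text \<open>
  The upper bound is the pointwise Fenchel inequality. For the lower bound, a purely finitely additive
  \<open>\<nu>s\<close> vanishes on every measurable subset of sets \<open>A n\<close> that increase to a set of full
  measure, because the lattice meet of its variation with the probability is \<open>\<sigma>\<close>-additive and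
  hence zero. So if \<open>X\<close> equals \<open>X0 \<in> UI_dom M f \<P>\<close> outside some \<open>A n\<close>, then
  \<open>\<nu>s\<close> gives \<open>X\<close> the same integral as \<open>X0\<close>, and only the regular part depends on \<open>X\<close>.
  If moreover the integrand along \<open>X\<close> is bounded above on \<open>A n\<close>, the uniform integrability for \<open>X0\<close>
  makes \<open>P \<mapsto> E[X Y] - E\<^sub>P[f(X)]\<close> lower semicontinuous for the weak topology, so that
  the minimax theorem of Kneser and Fan exchanges the supremum over such \<open>X\<close> with the infimum over
  \<open>\<P>\<close>. For a fixed \<open>P\<close>, these \<open>X\<close> are rich enough to reach the integral of
  \<open>ftilde\<close>, by a greedy choice among rational constants and monotone convergence.
\<close>

section \<open>Finitely additive set functions\<close>

text \<open>The minimax argument needs real values, while \<open>f\<close> may be unbounded on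
  either side along a bounded \<open>X\<close>. For each \<open>P\<close> the hypothesis on
  \<open>ftilde\<close> yields an integrable affine minorant of the integrand, so only upper bounds
  have to be arranged, and these come from the shape of the competitors. The minorant varies with
  \<open>P\<close>, so lower tails are not controlled uniformly over \<open>\<P>\<close>; but
  semicontinuity is wanted in one direction only. Clipping the integrand at \<open>- j\<close> and
  \<open>j\<close> gives a bounded function, whose expectation is weakly continuous in the density.
  Clipping from below errs on the harmless side, and the error of clipping from above is bounded by
  the tail of \<open>X0\<close>, uniformly in \<open>P\<close>. Compactness reduces the problem to
  finitely many competitors, after which minimax is pure convexity. Since \<open>f\<close> is almost
  everywhere finite, it is continuous in \<open>x\<close>, so its Fenchel envelope is a supremum
  over the rationals, and a countable greedy choice can take the place of a measurable
  selection.\<close>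

definition positive_part :: "'a measure \<Rightarrow> ('a set \<Rightarrow> real) \<Rightarrow> 'a set \<Rightarrow> real" where
  "positive_part M \<nu> A = (SUP B\<in>{B \<in> sets M. B \<subseteq> A}. \<nu> B)"

lemma ba_bound:
  assumes "\<nu> \<in> ba M"
  obtains C where "\<And>A. A \<in> sets M \<Longrightarrow> \<bar>\<nu> A\<bar> \<le> C" "C \<ge> 0"
proof -
  from assms obtain C where C: "\<And>A. A \<in> sets M \<Longrightarrow> \<bar>\<nu> A\<bar> \<le> C" by (auto simp: ba_def)
  from C[of "{}"] have "C \<ge> 0" by auto
  with C that show thesis by blast
qed

lemma ba_Un:
  assumes "\<nu> \<in> ba M" "A \<in> sets M" "B \<in> sets M" "A \<inter> B = {}"
  shows "\<nu> (A \<union> B) = \<nu> A + \<nu> B"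
  using assms by (auto simp: ba_def additive_def)

lemma ba_Diff:
  assumes "\<nu> \<in> ba M" "A \<in> sets M" "B \<in> sets M" "B \<subseteq> A"
  shows "\<nu> (A - B) = \<nu> A - \<nu> B"
  using ba_Un[OF assms(1), of "A - B" B] assms by (auto simp: Un_absorb2 Diff_Int_distrib2)

lemma ba_add:
  assumes "\<nu> \<in> ba M" "\<mu> \<in> ba M"
  shows "(\<lambda>A. \<nu> A + \<mu> A) \<in> ba M"
proof -
  obtain C D where "\<And>A. A \<in> sets M \<Longrightarrow> \<bar>\<nu> A\<bar> \<le> C" "\<And>A. A \<in> sets M \<Longrightarrow> \<bar>\<mu> A\<bar> \<le> D"
    using assms ba_bound by metis
  then have "\<forall>A\<in>sets M. \<bar>\<nu> A + \<mu> A\<bar> \<le> C + D" by (meson abs_triangle_ineq add_mono order_trans)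
  then show ?thesis using assms by (auto simp: ba_def additive_def)
qed

lemma ba_uminus: "\<nu> \<in> ba M \<Longrightarrow> (\<lambda>A. - \<nu> A) \<in> ba M"
  by (auto simp: ba_def additive_def)

lemma ba_diff:
  assumes "\<nu> \<in> ba M" "\<mu> \<in> ba M"
  shows "(\<lambda>A. \<nu> A - \<mu> A) \<in> ba M"
  using ba_add[OF assms(1) ba_uminus[OF assms(2)]] by simp

lemma (in finite_measure) measure_ba: "measure M \<in> ba M"
  by (auto simp: ba_def additive_def finite_measure_Union intro!: exI[of _ "measure M (space M)"] bounded_measure
      dest: null_setsD1 simp: measure_eq_0_null_sets)

lemma positive_part_upper:
  assumes "\<nu> \<in> ba M" "B \<in> sets M" "B \<subseteq> A"
  shows "\<nu> B \<le> positive_part M \<nu> A"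
proof -
  obtain C where "\<And>A. A \<in> sets M \<Longrightarrow> \<bar>\<nu> A\<bar> \<le> C" using assms(1) ba_bound by metis
  then have "bdd_above (\<nu> ` {B \<in> sets M. B \<subseteq> A})" by (auto simp: abs_le_iff intro!: bdd_aboveI2)
  then show ?thesis unfolding positive_part_def using assms by (intro cSUP_upper) auto
qed

lemma positive_part_least:
  assumes "\<And>B. B \<in> sets M \<Longrightarrow> B \<subseteq> A \<Longrightarrow> \<nu> B \<le> c"
  shows "positive_part M \<nu> A \<le> c"
  unfolding positive_part_def by (rule cSUP_least) (use assms in auto)

lemma positive_part_nonneg: "\<nu> \<in> ba M \<Longrightarrow> 0 \<le> positive_part M \<nu> A"
  using positive_part_upper[of \<nu> M "{}" A] by (simp add: ba_empty)

text \<open>Subsets of a disjoint union split along it, which gives one inequality; for the other,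
  the supremum is taken over subsets of each part in turn while the other subset is held
  fixed.\<close>

lemma positive_part_ba:
  assumes nu: "\<nu> \<in> ba M"
  shows "positive_part M \<nu> \<in> ba M"
proof -
  obtain C where C: "\<And>A. A \<in> sets M \<Longrightarrow> \<bar>\<nu> A\<bar> \<le> C" using nu ba_bound by metis
  have "positive_part M \<nu> (A \<union> A') = positive_part M \<nu> A + positive_part M \<nu> A'"
    if A: "A \<in> sets M" "A' \<in> sets M" "A \<inter> A' = {}" for A A'
  proof (rule antisym)
    show "positive_part M \<nu> (A \<union> A') \<le> positive_part M \<nu> A + positive_part M \<nu> A'"
    proof (rule positive_part_least)
      fix B assume B: "B \<in> sets M" "B \<subseteq> A \<union> A'"
      have "\<nu> B = \<nu> ((B \<inter> A) \<union> (B \<inter> A'))" using B by (intro arg_cong[of _ _ \<nu>]) auto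
      also have "\<dots> = \<nu> (B \<inter> A) + \<nu> (B \<inter> A')" using A B by (intro ba_Un[OF nu]) auto
      finally show "\<nu> B \<le> positive_part M \<nu> A + positive_part M \<nu> A'"
        using A B positive_part_upper[OF nu, of "B \<inter> A" A] positive_part_upper[OF nu, of "B \<inter> A'" A'] by auto
    qed
    have "positive_part M \<nu> A \<le> positive_part M \<nu> (A \<union> A') - positive_part M \<nu> A'"
    proof (rule positive_part_least)
      fix B assume B: "B \<in> sets M" "B \<subseteq> A"
      have "positive_part M \<nu> A' \<le> positive_part M \<nu> (A \<union> A') - \<nu> B"
      proof (rule positive_part_least)
        fix B' assume B': "B' \<in> sets M" "B' \<subseteq> A'"
        have "\<nu> (B \<union> B') = \<nu> B + \<nu> B'" using B B' A by (intro ba_Un[OF nu]) auto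
        then show "\<nu> B' \<le> positive_part M \<nu> (A \<union> A') - \<nu> B"
          using positive_part_upper[OF nu, of "B \<union> B'" "A \<union> A'"] B B' by (auto simp: le_supI1 le_supI2)
      qed
      then show "\<nu> B \<le> positive_part M \<nu> (A \<union> A') - positive_part M \<nu> A'" by simp
    qed
    then show "positive_part M \<nu> A + positive_part M \<nu> A' \<le> positive_part M \<nu> (A \<union> A')" by simp
  qed
  moreover have "\<bar>positive_part M \<nu> A\<bar> \<le> C" if "A \<in> sets M" for A
    using positive_part_nonneg[OF nu, of A] positive_part_least[of M A \<nu> C] C by (force simp: abs_le_iff)
  moreover have "positive_part M \<nu> A = 0" if "A \<in> null_sets M" for A
  proof (rule antisym[OF positive_part_least positive_part_nonneg[OF nu]])
    fix B assume "B \<in> sets M" "B \<subseteq> A"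
    with that have "B \<in> null_sets M" by (meson null_sets_subset)
    then show "\<nu> B \<le> 0" using nu by (simp add: ba_def)
  qed
  ultimately show ?thesis by (auto simp: ba_def additive_def)
qed

text \<open>The remainder of a disjoint union after \<open>n\<close> members has measure tending to
  0; domination forces the same on \<open>\<nu>\<close>, and finite additivity turns it into
  convergence of the partial sums.\<close>

lemma (in finite_measure) sigma_additive_dominated:
  assumes nu: "\<nu> \<in> ba M" and le: "\<And>A. A \<in> sets M \<Longrightarrow> 0 \<le> \<nu> A \<and> \<nu> A \<le> measure M A"
  shows "sigma_additive M \<nu>"
  unfolding sigma_additive_def
proof (intro allI impI)
  fix A :: "nat \<Rightarrow> 'a set" assume A: "range A \<subseteq> sets M" "disjoint_family A"
  have sum: "\<mu> (\<Union>i. A i) - (\<Sum>i<n. \<mu> (A i)) = \<mu> ((\<Union>i. A i) - (\<Union>i<n. A i))" if "\<mu> \<in> ba M" for \<mu> n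
    using ba_finite_Union[OF that, of "{..<n}" A] ba_Diff[OF that, of "\<Union>i. A i" "\<Union>i<n. A i"] A
    by (force simp: disjoint_family_on_def)
  have "(\<lambda>n. measure M (\<Union>i. A i) - (\<Sum>i<n. measure M (A i))) \<longlonglongrightarrow> measure M (\<Union>i. A i) - measure M (\<Union>i. A i)"
    using finite_measure_UNION[OF A] unfolding sums_def by (intro tendsto_intros)
  then have lim: "(\<lambda>n. measure M ((\<Union>i. A i) - (\<Union>i<n. A i))) \<longlonglongrightarrow> 0"
    by (simp add: sum[OF measure_ba])
  have "(\<lambda>n. \<nu> ((\<Union>i. A i) - (\<Union>i<n. A i))) \<longlonglongrightarrow> 0"
    by (rule tendsto_sandwich[OF _ _ tendsto_const lim]) (use le A in auto)
  then have "(\<lambda>n. \<nu> (\<Union>i. A i) - (\<nu> (\<Union>i. A i) - (\<Sum>i<n. \<nu> (A i)))) \<longlonglongrightarrow> \<nu> (\<Union>i. A i) - 0"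
    unfolding sum[OF nu] by (intro tendsto_intros)
  then show "(\<lambda>i. \<nu> (A i)) sums \<nu> (\<Union>i. A i)" by (simp add: sums_def)
qed

section \<open>Purely finitely additive set functions and the sets they ignore\<close>

lemma variation_ge:
  assumes nu: "\<nu> \<in> ba M" and "A \<in> sets M" "B \<in> sets M" "B \<subseteq> A"
  shows "\<nu> B - \<nu> (A - B) \<le> variation M \<nu> A"
proof -
  obtain C where C: "\<And>A. A \<in> sets M \<Longrightarrow> \<bar>\<nu> A\<bar> \<le> C" using nu ba_bound by metis
  \<comment> \<open>A supremum of reals is informative only for bounded sets. The bound is
    \<open>2 * C\<close> because blocks of nonnegative and of negative value are collected
    separately.\<close>
  have "bdd_above ((\<lambda>\<pi>. \<Sum>B\<in>\<pi>. \<bar>\<nu> B\<bar>) ` {\<pi>. finite \<pi> \<and> \<pi> \<subseteq> sets M \<and> partition_on A \<pi>})"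
  proof (rule bdd_aboveI2)
    fix \<pi> assume "\<pi> \<in> {\<pi>. finite \<pi> \<and> \<pi> \<subseteq> sets M \<and> partition_on A \<pi>}"
    then show "(\<Sum>B\<in>\<pi>. \<bar>\<nu> B\<bar>) \<le> 2 * C"
      using ba_sum_abs_le[OF nu C, of \<pi> "\<lambda>B. B"]
      by (auto simp: partition_on_def disjoint_family_on_def disjoint_def)
  qed
  moreover have "{B, A - B} - {{}} \<in> {\<pi>. finite \<pi> \<and> \<pi> \<subseteq> sets M \<and> partition_on A \<pi>}"
    using assms by (auto simp: partition_on_def disjoint_def)
  ultimately have "(\<Sum>B\<in>{B, A - B} - {{}}. \<bar>\<nu> B\<bar>) \<le> variation M \<nu> A"
    unfolding variation_def by (intro cSUP_upper)
  moreover have "(\<Sum>B\<in>{B, A - B} - {{}}. \<bar>\<nu> B\<bar>) = (\<Sum>B\<in>{B, A - B}. \<bar>\<nu> B\<bar>)"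
    by (intro sum.mono_neutral_left) (auto simp: ba_empty[OF nu])
  moreover have "(\<Sum>B\<in>{B, A - B}. \<bar>\<nu> B\<bar>) = \<bar>\<nu> B\<bar> + \<bar>\<nu> (A - B)\<bar>"
  \<comment> \<open>Equal blocks would merge in the set \<open>{B, A - B}\<close>, but then both are
    empty.\<close>
  proof (cases "B = A - B")
    case True
    then have "B = {}" "A - B = {}" by auto
    then show ?thesis by (simp add: ba_empty[OF nu])
  qed auto
  ultimately show ?thesis by linarith
qed

text \<open>The meet of set functions \<open>a\<close> and \<open>b\<close> is \<open>a\<close>
  minus the positive part of \<open>a - b\<close>. For the probability and the variation it is
  countably additive, being dominated by the probability, so pure finite additivity makes it 0.
  Hence \<open>prob B - l B\<close> comes arbitrarily close to 1, and a near-maximizer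
  \<open>B\<close> has almost full probability and almost no variation.\<close>

lemma (in prob_space) purely_finitely_additive_almost_vanishes:
  assumes nu: "\<nu> \<in> ba M" and pfa: "purely_finitely_additive M \<nu>" and e: "e > 0"
  shows "\<exists>B\<in>sets M. prob (space M - B) < e \<and> (\<forall>B'\<in>sets M. B' \<subseteq> B \<longrightarrow> \<bar>\<nu> B'\<bar> \<le> e)"
proof -
  \<comment> \<open>The variation as a sum of positive and negative part: in this form its
    additivity comes from \<open>positive_part_ba\<close>, and only
    \<open>l A \<le> variation M \<nu> A\<close> remains to be shown.\<close>
  define l where "l = (\<lambda>A. positive_part M \<nu> A + positive_part M (\<lambda>A. - \<nu> A) A)"
  have l: "l \<in> ba M" unfolding l_def by (intro ba_add positive_part_ba nu ba_uminus)
  have nul: "\<bar>\<nu> B\<bar> \<le> l A" if "B \<in> sets M" "B \<subseteq> A" for A B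
    using positive_part_upper[OF nu that] positive_part_upper[OF ba_uminus[OF nu] that]
      positive_part_nonneg[OF nu, of A] positive_part_nonneg[OF ba_uminus[OF nu], of A]
    unfolding l_def by linarith
  have lnn: "0 \<le> l A" for A unfolding l_def by (intro add_nonneg_nonneg positive_part_nonneg nu ba_uminus)
  have lvar: "l A \<le> variation M \<nu> A" if A: "A \<in> sets M" for A
  proof -
    have "positive_part M (\<lambda>A. - \<nu> A) A \<le> variation M \<nu> A - positive_part M \<nu> A"
    proof (rule positive_part_least)
      fix D assume D: "D \<in> sets M" "D \<subseteq> A"
      have "positive_part M \<nu> A \<le> variation M \<nu> A + \<nu> D"
      proof (rule positive_part_least)
        fix B assume B: "B \<in> sets M" "B \<subseteq> A"
        \<comment> \<open>\<open>B\<close> and \<open>D\<close> may overlap, but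
          \<open>\<nu> (B \<inter> D)\<close> cancels in \<open>\<nu> B - \<nu> D\<close>. The rest
          \<open>?Y\<close> of \<open>A\<close> is put once into either block of a two-block
          partition; in the sum of the two estimates it cancels too.\<close>
        have "\<nu> (B - D \<union> B \<inter> D) = \<nu> (B - D) + \<nu> (B \<inter> D)" "\<nu> (D - B \<union> B \<inter> D) = \<nu> (D - B) + \<nu> (B \<inter> D)"
          using B D by (intro ba_Un[OF nu]; auto)+
        moreover have "B - D \<union> B \<inter> D = B" "D - B \<union> B \<inter> D = D" by auto
        moreover
        let ?X = "(B - D)" and ?Y = "A - ((B - D) \<union> (D - B))"
        have "\<nu> ?X - \<nu> (A - ?X) \<le> variation M \<nu> A"
          "\<nu> (?X \<union> ?Y) - \<nu> (A - (?X \<union> ?Y)) \<le> variation M \<nu> A"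
          using B D A by (intro variation_ge[OF nu]; blast)+
        moreover have "A - ?X = ?Y \<union> (D - B)" "A - (?X \<union> ?Y) = D - B" using B D by auto
        moreover have "\<nu> (?Y \<union> (D - B)) = \<nu> ?Y + \<nu> (D - B)" "\<nu> (?X \<union> ?Y) = \<nu> ?X + \<nu> ?Y"
          using A B D by (intro ba_Un[OF nu]; auto)+
        ultimately show "\<nu> B \<le> variation M \<nu> A + \<nu> D" by (simp del: Un_Diff_cancel2)
      qed
      then show "- \<nu> D \<le> variation M \<nu> A - positive_part M \<nu> A" by simp
    qed
    then show ?thesis by (simp add: l_def)
  qed
  text \<open>\<open>\<mu>\<close> is the lattice meet of the probability and of the variation of \<open>\<nu>\<close>.\<close>
  define d where "d = (\<lambda>A. prob A - l A)"
  define \<mu> where "\<mu> A = prob A - positive_part M d A" for A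
  have d: "d \<in> ba M" unfolding d_def by (intro ba_diff measure_ba l)
  have mu: "\<mu> \<in> ba M" unfolding \<mu>_def by (intro ba_diff measure_ba positive_part_ba d)
  have "0 \<le> \<mu> A \<and> \<mu> A \<le> prob A \<and> \<mu> A \<le> l A" if A: "A \<in> sets M" for A
  proof -
    have "positive_part M d A \<le> prob A"
    proof (rule positive_part_least)
      fix B assume "B \<in> sets M" "B \<subseteq> A"
      then have "prob B \<le> prob A" using A by (intro finite_measure_mono)
      then show "d B \<le> prob A" using lnn[of B] by (simp add: d_def)
    qed
    moreover have "d A \<le> positive_part M d A" using A by (intro positive_part_upper d) auto
    ultimately show ?thesis using positive_part_nonneg[OF d, of A] by (simp add: \<mu>_def d_def)
  qed
  then have "\<forall>A\<in>sets M. 0 \<le> \<mu> A \<and> \<mu> A \<le> variation M \<nu> A" "sigma_additive M \<mu>"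
    using lvar sigma_additive_dominated[OF mu] by force+
  then have "\<mu> (space M) = 0" using pfa mu by (auto simp: purely_finitely_additive_def)
  then have "1 - e < positive_part M d (space M)" using e by (simp add: \<mu>_def prob_space)
  then obtain B where B: "B \<in> sets M" "1 - e < d B"
    using positive_part_least[of M "space M" d "1 - e"] by (metis not_le)
  then have "prob (space M - B) < e" "l B \<le> e"
    using lnn[of B] prob_compl[OF B(1)] prob_le_1[of B] unfolding d_def by linarith+
  moreover from this have "\<bar>\<nu> B'\<bar> \<le> e" if "B' \<in> sets M" "B' \<subseteq> B" for B' using nul[OF that] by linarith
  ultimately show ?thesis using B(1) by blast
qed

text \<open>Intersecting sets on which \<open>\<nu>\<close> is at most
  \<open>e * (1/2)^Suc k\<close> in absolute value makes it vanish exactly, at a loss of probability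
  at most \<open>e\<close>. Finite unions then let the loss tend to 0.\<close>

lemma (in prob_space) purely_finitely_additive_carrier:
  assumes nu: "\<nu> \<in> ba M" and pfa: "purely_finitely_additive M \<nu>"
  shows "\<exists>A. incseq A \<and> range A \<subseteq> sets M \<and> (AE \<omega> in M. \<exists>n. \<omega> \<in> A n) \<and>
    (\<forall>n. \<forall>B\<in>sets M. B \<subseteq> A n \<longrightarrow> \<nu> B = 0)"
proof -
  have ex: "\<exists>D\<in>sets M. prob (space M - D) \<le> e \<and> (\<forall>B\<in>sets M. B \<subseteq> D \<longrightarrow> \<nu> B = 0)" if e: "e > 0" for e
  proof -
    have "\<forall>k. \<exists>D. D\<in>sets M \<and> prob (space M - D) < e * (1/2)^Suc k \<and> (\<forall>B'\<in>sets M. B' \<subseteq> D \<longrightarrow> \<bar>\<nu> B'\<bar> \<le> e * (1/2)^Suc k)"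
    proof
      fix k :: nat
      have "e * (1/2)^Suc k > 0" using e by simp
      from purely_finitely_additive_almost_vanishes[OF nu pfa this]
      show "\<exists>D. D\<in>sets M \<and> prob (space M - D) < e * (1/2)^Suc k \<and> (\<forall>B'\<in>sets M. B' \<subseteq> D \<longrightarrow> \<bar>\<nu> B'\<bar> \<le> e * (1/2)^Suc k)"
        by blast
    qed
    then obtain D where D: "\<And>k::nat. D k \<in> sets M" "\<And>k. prob (space M - D k) < e * (1/2)^Suc k"
      "\<And>k B. B \<in> sets M \<Longrightarrow> B \<subseteq> D k \<Longrightarrow> \<bar>\<nu> B\<bar> \<le> e * (1/2)^Suc k" by metis
    \<comment> \<open>The exponent starts at 1 so that the losses add up to exactly
      \<open>e\<close>.\<close>
    have s: "(\<lambda>k. e * (1/2)^Suc k) sums (e * 1)" by (intro sums_mult power_half_series)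
    have sm: "summable (\<lambda>k. prob (space M - D k))"
      using D(2) by (intro summable_comparison_test'[OF sums_summable[OF s], of 0]) (auto intro: less_imp_le)
    have "prob (space M - (\<Inter>k. D k)) = prob (\<Union>k. space M - D k)" by (intro arg_cong[of _ _ prob]) auto
    also have "\<dots> \<le> (\<Sum>k. prob (space M - D k))"
      using D(1) sm by (intro finite_measure_subadditive_countably) auto
    also have "\<dots> \<le> (\<Sum>k. e * (1/2)^Suc k)"
      using D(2) by (intro suminf_le sm sums_summable[OF s]) (auto intro: less_imp_le)
    also have "\<dots> = e" using s by (simp add: sums_iff)
    finally have "prob (space M - (\<Inter>k. D k)) \<le> e" .
    moreover have "\<nu> B = 0" if B: "B \<in> sets M" "B \<subseteq> (\<Inter>k. D k)" for B
    proof -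
      have "(\<lambda>k. e * (1/2)^Suc k) \<longlonglongrightarrow> 0" using s by (intro summable_LIMSEQ_zero) (auto simp: sums_iff)
      then have "\<bar>\<nu> B\<bar> \<le> 0" by (rule LIMSEQ_le_const) (use D(3) B in blast)
      then show ?thesis by simp
    qed
    ultimately show ?thesis using D(1) by (intro bexI[of _ "\<Inter>k. D k"]) auto
  qed
  have "\<forall>n. \<exists>D. D\<in>sets M \<and> prob (space M - D) \<le> inverse (Suc n) \<and> (\<forall>B\<in>sets M. B \<subseteq> D \<longrightarrow> \<nu> B = 0)"
    using ex by (force simp: Bex_def)
  then obtain D where D: "\<And>n::nat. D n \<in> sets M" "\<And>n. prob (space M - D n) \<le> inverse (Suc n)"
    "\<And>n B. B \<in> sets M \<Longrightarrow> B \<subseteq> D n \<Longrightarrow> \<nu> B = 0" by metis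
  \<comment> \<open>Finite additivity carries the vanishing of \<open>\<nu>\<close> to each finite
    union \<open>A n\<close>, but not to the union of all of them.\<close>
  define A where "A n = (\<Union>i<n. D i)" for n
  have "\<nu> B = 0" if "B \<in> sets M" "B \<subseteq> A n" for n B
    using that
  proof (induction n arbitrary: B)
    case 0
    then show ?case by (simp add: A_def ba_empty[OF nu])
  next
    case (Suc n)
    have "\<nu> B = \<nu> ((B - D n) \<union> (B \<inter> D n))" by (simp add: Un_Diff_Int)
    also have "\<dots> = \<nu> (B - D n) + \<nu> (B \<inter> D n)" using Suc.prems D(1) by (intro ba_Un[OF nu]) auto
    also have "\<nu> (B - D n) = 0" using Suc.prems D(1) by (intro Suc.IH) (auto simp: A_def lessThan_Suc)
    also have "\<nu> (B \<inter> D n) = 0" using Suc.prems D(1) D(3)[of "B \<inter> D n" n] by auto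
    finally show ?case by simp
  qed
  moreover have "AE \<omega> in M. \<exists>n. \<omega> \<in> A n"
  proof -
    have "prob (space M - (\<Union>n. D n)) \<le> inverse (Suc n)" for n
      using D(1) by (intro order_trans[OF finite_measure_mono D(2)]) auto
    then have "prob (space M - (\<Union>n. D n)) \<le> 0"
      by (intro LIMSEQ_le_const[OF LIMSEQ_inverse_real_of_nat]) auto
    then have "space M - (\<Union>n. D n) \<in> null_sets M"
      using D(1) by (auto simp: null_sets_def emeasure_eq_measure measure_le_0_iff)
    from AE_not_in[OF this] show ?thesis
      using AE_space by eventually_elim (auto simp: A_def)
  qed
  moreover have "incseq A" unfolding A_def by (force simp: incseq_def)
  moreover have "range A \<subseteq> sets M" unfolding A_def using D(1) by auto
  ultimately show ?thesis by blast
qed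

section \<open>Integration with respect to finitely additive set functions\<close>

text \<open>Frees the integral from the one approximating sequence that
  \<open>has_ba_integral\<close> provides: two sequences with the same limit are eventually close up
  to null sets, and so are their integrals. Later proofs can choose a convenient sequence.\<close>

lemma ba_integral_LIMSEQ:
  assumes nu: "\<nu> \<in> ba M" and X: "X \<in> Linf M"
    and s: "\<And>n. simple_function M (s n)" and sX: "Linf_tendsto M s X"
  shows "(\<lambda>n. simple_ba_integral M \<nu> (s n)) \<longlonglongrightarrow> ba_integral M \<nu> X"
proof -
  obtain C where C: "\<And>A. A \<in> sets M \<Longrightarrow> \<bar>\<nu> A\<bar> \<le> C" "C \<ge> 0" using nu ba_bound by metis
  obtain t where t: "\<And>n. simple_function M (t n)" "Linf_tendsto M t X"
      "(\<lambda>n. simple_ba_integral M \<nu> (t n)) \<longlonglongrightarrow> ba_integral M \<nu> X"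
    using has_ba_integral_ba_integral[OF nu X] unfolding has_ba_integral_def by auto
  have "(\<lambda>n. simple_ba_integral M \<nu> (s n) - simple_ba_integral M \<nu> (t n)) \<longlonglongrightarrow> 0"
  proof (rule LIMSEQ_I)
    fix r :: real assume r: "r > 0"
    \<comment> \<open>Both sequences are within \<open>e\<close> of \<open>X\<close>, so the
      integrals differ by at most \<open>2 * e * (2 * C)\<close>. The summand 1 in
      \<open>C + 1\<close> covers \<open>C = 0\<close>.\<close>
    define e where "e = r / (8 * (C + 1))"
    have e: "e > 0" using r C by (simp add: e_def)
    have "2 * e * (2 * C) = r * (C / (2 * (C + 1)))" using C by (simp add: e_def field_simps)
    also have "\<dots> < r * 1" using r C by (intro mult_strict_left_mono) (auto simp: field_simps)
    finally have lt: "2 * e * (2 * C) < r" by simp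
    have "\<forall>\<^sub>F n in sequentially. AE \<omega> in M. \<bar>s n \<omega> - X \<omega>\<bar> \<le> e"
      "\<forall>\<^sub>F n in sequentially. AE \<omega> in M. \<bar>t n \<omega> - X \<omega>\<bar> \<le> e"
      using sX t(2) e by (auto simp: Linf_tendsto_def)
    then have "\<forall>\<^sub>F n in sequentially. norm (simple_ba_integral M \<nu> (s n) - simple_ba_integral M \<nu> (t n) - 0) < r"
    proof eventually_elim
      case (elim n)
      then have "AE \<omega> in M. \<bar>s n \<omega> - t n \<omega>\<bar> \<le> 2 * e" by eventually_elim auto
      then have "\<bar>simple_ba_integral M \<nu> (s n) - simple_ba_integral M \<nu> (t n)\<bar> \<le> 2 * e * (2 * C)"
        using e by (intro simple_ba_integral_diff_le[OF nu C(1) s t(1)]) auto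
      then show ?case using lt by simp
    qed
    then show "\<exists>no. \<forall>n\<ge>no. norm (simple_ba_integral M \<nu> (s n) - simple_ba_integral M \<nu> (t n) - 0) < r"
      by (simp add: eventually_sequentially)
  qed
  from tendsto_add[OF this t(3)] show ?thesis by simp
qed

text \<open>The zero set function belongs to \<open>ba M\<close>, so existence of its integral
  already yields a sequence of the required kind.\<close>

lemma Linf_simple_approx_tendsto:
  assumes "X \<in> Linf M"
  obtains s where "\<And>n. simple_function M (s n)" "Linf_tendsto M s X"
  using has_ba_integral_exists[of "\<lambda>_. 0" M X] assms
  by (auto simp: has_ba_integral_def ba_def additive_def)

lemma ba_integral_split:
  assumes "\<nu> \<in> ba M" "\<nu>r \<in> ba M" "\<nu>s \<in> ba M" "\<And>A. A \<in> sets M \<Longrightarrow> \<nu> A = \<nu>r A + \<nu>s A" and X: "X \<in> Linf M"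
  shows "ba_integral M \<nu> X = ba_integral M \<nu>r X + ba_integral M \<nu>s X"
proof -
  obtain s where s: "\<And>n. simple_function M (s n)" "Linf_tendsto M s X"
    using Linf_simple_approx_tendsto[OF X] by blast
  have "simple_ba_integral M \<nu> (s n) = simple_ba_integral M \<nu>r (s n) + simple_ba_integral M \<nu>s (s n)" for n
    unfolding simple_ba_integral_def sum.distrib[symmetric]
  proof (rule sum.cong[OF refl])
    fix v assume "v \<in> s n ` space M"
    then have "s n -` {v} \<inter> space M \<in> sets M" using s(1)[of n] by (auto simp: simple_function_def)
    then show "v * \<nu> (s n -` {v} \<inter> space M) = v * \<nu>r (s n -` {v} \<inter> space M) + v * \<nu>s (s n -` {v} \<inter> space M)"
      by (simp add: assms(4) distrib_left)
  qed
  then have "(\<lambda>n. simple_ba_integral M \<nu> (s n)) \<longlonglongrightarrow> ba_integral M \<nu>r X + ba_integral M \<nu>s X"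
    using ba_integral_LIMSEQ[OF assms(2) X s] ba_integral_LIMSEQ[OF assms(3) X s] by (simp add: tendsto_add)
  with ba_integral_LIMSEQ[OF assms(1) X s] show ?thesis by (rule LIMSEQ_unique)
qed

text \<open>Simple approximations of \<open>X\<close> and \<open>X'\<close> are spliced along
  \<open>A\<close>. The result approximates \<open>X'\<close>, yet its simple integrals are those of
  the approximations of \<open>X\<close>, because \<open>\<nu>\<close> does not see what happens on
  \<open>A\<close>.\<close>

lemma ba_integral_cong_carrier:
  assumes nu: "\<nu> \<in> ba M" and X: "X \<in> Linf M" "X' \<in> Linf M" and A: "A \<in> sets M"
    and 0: "\<And>B. B \<in> sets M \<Longrightarrow> B \<subseteq> A \<Longrightarrow> \<nu> B = 0"
    and eq: "\<And>\<omega>. \<omega> \<in> space M - A \<Longrightarrow> X \<omega> = X' \<omega>"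
  shows "ba_integral M \<nu> X = ba_integral M \<nu> X'"
proof -
  obtain s where s: "\<And>n. simple_function M (s n)" "Linf_tendsto M s X"
    using Linf_simple_approx_tendsto[OF X(1)] by blast
  obtain t where t: "\<And>n. simple_function M (t n)" "Linf_tendsto M t X'"
    using Linf_simple_approx_tendsto[OF X(2)] by blast
  define u where "u n \<omega> = (if \<omega> \<in> A then t n \<omega> else s n \<omega>)" for n \<omega>
  have u: "simple_function M (u n)" for n
    unfolding u_def using A by (intro simple_function_If_set s t) (auto simp: Int_absorb2 sets.sets_into_space)
  have uX: "Linf_tendsto M u X'"
    unfolding Linf_tendsto_def
  proof (intro allI impI)
    fix e :: real assume "e > 0"
    then have "\<forall>\<^sub>F n in sequentially. AE \<omega> in M. \<bar>s n \<omega> - X \<omega>\<bar> \<le> e"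
      "\<forall>\<^sub>F n in sequentially. AE \<omega> in M. \<bar>t n \<omega> - X' \<omega>\<bar> \<le> e"
      using s(2) t(2) by (auto simp: Linf_tendsto_def)
    then show "\<forall>\<^sub>F n in sequentially. AE \<omega> in M. \<bar>u n \<omega> - X' \<omega>\<bar> \<le> e"
    proof eventually_elim
      case (elim n)
      then show ?case using AE_space by eventually_elim (auto simp: u_def eq)
    qed
  qed
  have "simple_ba_integral M \<nu> (u n) = simple_ba_integral M \<nu> (s n)" for n
  proof -
    let ?V = "u n ` space M \<union> s n ` space M"
    have fin: "finite ?V" using u[of n] s(1)[of n] by (auto simp: simple_function_def)
    have ext: "simple_ba_integral M \<nu> w = (\<Sum>v\<in>?V. v * \<nu> (w -` {v} \<inter> space M))"
      if "w ` space M \<subseteq> ?V" for w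
      unfolding simple_ba_integral_def
    proof (rule sum.mono_neutral_left[OF fin that], rule ballI)
      fix v assume "v \<in> ?V - w ` space M"
      then have "w -` {v} \<inter> space M = {}" by auto
      then show "v * \<nu> (w -` {v} \<inter> space M) = 0" by (simp add: ba_empty[OF nu])
    qed
    have minus: "\<nu> B = \<nu> (B - A)" if "B \<in> sets M" for B
    proof -
      have "\<nu> ((B - A) \<union> (B \<inter> A)) = \<nu> (B - A) + \<nu> (B \<inter> A)" using that A by (intro ba_Un[OF nu]) auto
      then show ?thesis using that A 0[of "B \<inter> A"] by (simp add: Un_Diff_Int)
    qed
    have "\<nu> (u n -` {v} \<inter> space M) = \<nu> (s n -` {v} \<inter> space M)" for v
    proof -
      have "(u n -` {v} \<inter> space M) - A = (s n -` {v} \<inter> space M) - A" by (auto simp: u_def)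
      then show ?thesis
        using minus[OF simple_functionD(2)[OF u[of n], of "{v}"]] minus[OF simple_functionD(2)[OF s(1)[of n], of "{v}"]]
        by simp
    qed
    then show ?thesis using ext[of "u n"] ext[of "s n"] by simp
  qed
  then have "(\<lambda>n. simple_ba_integral M \<nu> (s n)) \<longlonglongrightarrow> ba_integral M \<nu> X'"
    using ba_integral_LIMSEQ[OF nu X(2) u uX] by simp
  with ba_integral_LIMSEQ[OF nu X(1) s] show ?thesis by (rule LIMSEQ_unique)
qed

section \<open>Densities of countably additive set functions\<close>

lemma sigma_additive_positive_part:
  assumes nu: "\<nu> \<in> ba M" and sa: "sigma_additive M \<nu>"
  shows "sigma_additive M (positive_part M \<nu>)"
  unfolding sigma_additive_def
proof (intro allI impI)
  fix A :: "nat \<Rightarrow> 'a set" assume A: "range A \<subseteq> sets M" "disjoint_family A"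
  let ?p = "positive_part M \<nu>"
  note p = positive_part_ba[OF nu] and p0 = positive_part_nonneg[OF nu]
  have le: "(\<Sum>i<n. ?p (A i)) \<le> ?p (\<Union>i. A i)" for n
  proof -
    have "?p (\<Union>i. A i) - ?p (\<Union>i<n. A i) = ?p ((\<Union>i. A i) - (\<Union>i<n. A i))"
      using A by (subst ba_Diff[OF p]) auto
    moreover have "?p (\<Union>i<n. A i) = (\<Sum>i<n. ?p (A i))"
      using A by (intro ba_finite_Union[OF p]) (auto simp: disjoint_family_on_def)
    ultimately show ?thesis using p0[of "(\<Union>i. A i) - (\<Union>i<n. A i)"] by simp
  qed
  have sm: "summable (\<lambda>i. ?p (A i))" by (rule summableI_nonneg_bounded[where x="?p (\<Union>i. A i)"]) (rule p0, rule le)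
  have "?p (\<Union>i. A i) \<le> (\<Sum>i. ?p (A i))"
  proof (rule positive_part_least)
    fix B assume B: "B \<in> sets M" "B \<subseteq> (\<Union>i. A i)"
    have "(\<lambda>i. \<nu> (B \<inter> A i)) sums \<nu> (\<Union>i. B \<inter> A i)"
    proof (rule sa[unfolded sigma_additive_def, rule_format])
      show "range (\<lambda>i. B \<inter> A i) \<subseteq> sets M" using A B by auto
      show "disjoint_family (\<lambda>i. B \<inter> A i)" using A(2) by (rule disjoint_family_on_bisimulation) auto
    qed
    moreover have "(\<Union>i. B \<inter> A i) = B" using B by auto
    ultimately have s: "(\<lambda>i. \<nu> (B \<inter> A i)) sums \<nu> B" by simp
    have "\<nu> (B \<inter> A i) \<le> ?p (A i)" for i using A B by (intro positive_part_upper[OF nu]) auto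
    then have "(\<Sum>i. \<nu> (B \<inter> A i)) \<le> (\<Sum>i. ?p (A i))" using s sm by (intro suminf_le) (auto simp: sums_iff)
    then show "\<nu> B \<le> (\<Sum>i. ?p (A i))" using s by (simp add: sums_iff)
  qed
  moreover have "(\<Sum>i. ?p (A i)) \<le> ?p (\<Union>i. A i)" by (rule suminf_le_const[OF sm le])
  ultimately show "(\<lambda>i. ?p (A i)) sums ?p (\<Union>i. A i)" using sm by (simp add: sums_iff)
qed

text \<open>Radon-Nikodym for the measure that \<open>\<nu>\<close> generates. Nonnegativity is
  asked of all sets, measurable or not, as \<open>positive_part\<close> satisfies it in this
  form.\<close>

lemma (in prob_space) nonneg_sigma_additive_density:
  assumes nu: "\<nu> \<in> ba M" and sa: "sigma_additive M \<nu>" and nonneg: "\<And>A. 0 \<le> \<nu> A"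
  shows "\<exists>Y\<in>L1 M. \<forall>A\<in>sets M. \<nu> A = (LINT \<omega>:A|M. Y \<omega>)"
proof -
  define N where "N = measure_of (space M) (sets M) (\<lambda>A. ennreal (\<nu> A))"
  have sN: "sets N = sets M" "space N = space M" by (auto simp: N_def)
  have emN: "emeasure N A = ennreal (\<nu> A)" if "A \<in> sets M" for A
    unfolding N_def
  proof (rule emeasure_measure_of_sigma[OF sets.sigma_algebra_axioms _ _ that])
    show "positive (sets M) (\<lambda>A. ennreal (\<nu> A))" by (simp add: positive_def ba_empty[OF nu])
    show "countably_additive (sets M) (\<lambda>A. ennreal (\<nu> A))"
      unfolding countably_additive_def
    proof (intro allI impI)
      fix A :: "nat \<Rightarrow> 'a set" assume "range A \<subseteq> sets M" "disjoint_family A"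
      then have "(\<lambda>i. \<nu> (A i)) sums \<nu> (\<Union>i. A i)" using sa by (auto simp: sigma_additive_def)
      then show "(\<Sum>i. ennreal (\<nu> (A i))) = ennreal (\<nu> (\<Union>i. A i))"
        using nonneg by (simp add: suminf_ennreal2 sums_iff)
    qed
  qed
  interpret N: finite_measure N by (rule finite_measureI) (simp add: sN emN)
  have "absolutely_continuous M N"
    using nu by (auto simp: absolutely_continuous_def null_sets_def sN emN ba_def)
  then obtain g where g: "g \<in> borel_measurable M" "density M g = N"
    using Radon_Nikodym[of N] sN by blast
  have "(\<integral>\<^sup>+\<omega>. g \<omega> \<partial>M) = emeasure N (space M)"
    using g emeasure_density[of g M "space M"] by (auto intro!: nn_integral_cong)
  then have fin: "(\<integral>\<^sup>+\<omega>. g \<omega> \<partial>M) < \<infinity>" using N.emeasure_finite[of "space M"] unfolding infinity_ennreal_def less_top by simp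
  then have gr: "AE \<omega> in M. g \<omega> = ennreal (enn2real (g \<omega>))"
    using nn_integral_PInf_AE[OF g(1)] by (auto simp: less_top elim!: eventually_mono)
  have int: "integrable M (\<lambda>\<omega>. enn2real (g \<omega>))"
  proof (rule integrableI_nonneg)
    show "(\<integral>\<^sup>+\<omega>. ennreal (enn2real (g \<omega>)) \<partial>M) < \<infinity>"
      using fin gr by (subst nn_integral_cong_AE[where v=g]) (auto elim!: eventually_mono)
  qed (use g in auto)
  have "\<nu> A = (LINT \<omega>:A|M. enn2real (g \<omega>))" if A: "A \<in> sets M" for A
  proof -
    have "ennreal (\<nu> A) = (\<integral>\<^sup>+\<omega>. g \<omega> * indicator A \<omega> \<partial>M)"
      using emN[OF A] g emeasure_density[OF g(1) A] by simp
    also have "\<dots> = (\<integral>\<^sup>+\<omega>. ennreal (indicator A \<omega> * enn2real (g \<omega>)) \<partial>M)"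
      using gr by (intro nn_integral_cong_AE) (auto elim!: eventually_mono simp: indicator_def)
    also have "\<dots> = ennreal (LINT \<omega>:A|M. enn2real (g \<omega>))"
      unfolding set_lebesgue_integral_def using int A
      by (subst nn_integral_eq_integral) (auto intro!: integrable_real_mult_indicator simp: mult.commute)
    finally show ?thesis
      using nonneg by (subst (asm) ennreal_inj) (auto simp: set_lebesgue_integral_def intro!: integral_nonneg_AE)
  qed
  then show ?thesis using int by (auto simp: L1_def)
qed

lemma (in prob_space) sigma_additive_density:
  assumes nu: "\<nu> \<in> ba M" and sa: "sigma_additive M \<nu>"
  shows "\<exists>Y\<in>L1 M. \<forall>A\<in>sets M. \<nu> A = (LINT \<omega>:A|M. Y \<omega>)"
proof -
  let ?p = "positive_part M \<nu>" and ?q = "positive_part M (\<lambda>A. - \<nu> A)"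
  have mnu: "(\<lambda>A. - \<nu> A) \<in> ba M" using nu by (rule ba_uminus)
  have msa: "sigma_additive M (\<lambda>A. - \<nu> A)" using sa by (auto simp: sigma_additive_def intro!: sums_minus)
  obtain Y where Y: "Y \<in> L1 M" "\<And>A. A \<in> sets M \<Longrightarrow> ?p A = (LINT \<omega>:A|M. Y \<omega>)"
    using nonneg_sigma_additive_density[of ?p] positive_part_ba sigma_additive_positive_part
      positive_part_nonneg nu sa by metis
  obtain Y' where Y': "Y' \<in> L1 M" "\<And>A. A \<in> sets M \<Longrightarrow> ?q A = (LINT \<omega>:A|M. Y' \<omega>)"
    using nonneg_sigma_additive_density[of ?q] positive_part_ba sigma_additive_positive_part
      positive_part_nonneg mnu msa by metis
  have "\<nu> A = (LINT \<omega>:A|M. Y \<omega> - Y' \<omega>)" if A: "A \<in> sets M" for A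
  proof -
    \<comment> \<open>Jordan decomposition: since \<open>\<nu> B = \<nu> A - \<nu> (A - B)\<close>,
      passing from \<open>B\<close> to \<open>A - B\<close> turns a candidate for one part into a
      candidate for the other.\<close>
    have "?p A \<le> \<nu> A + ?q A"
    proof (rule positive_part_least)
      fix B assume B: "B \<in> sets M" "B \<subseteq> A"
      show "\<nu> B \<le> \<nu> A + ?q A"
        using positive_part_upper[OF mnu, of "A - B" A] ba_Diff[OF nu A B] A B by auto
    qed
    moreover have "?q A \<le> ?p A - \<nu> A"
    proof (rule positive_part_least)
      fix B assume B: "B \<in> sets M" "B \<subseteq> A"
      show "- \<nu> B \<le> ?p A - \<nu> A"
        using positive_part_upper[OF nu, of "A - B" A] ba_Diff[OF nu A B] A B by auto
    qed
    ultimately have "\<nu> A = ?p A - ?q A" by simp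
    also have "\<dots> = (LINT \<omega>:A|M. Y \<omega> - Y' \<omega>)"
      using Y Y' A integrable_mult_indicator[OF A, of Y] integrable_mult_indicator[OF A, of Y']
      by (simp add: set_integral_diff L1_def set_integrable_def)
    finally show ?thesis .
  qed
  moreover have "(\<lambda>\<omega>. Y \<omega> - Y' \<omega>) \<in> L1 M" using Y Y' by (auto simp: L1_def)
  ultimately show ?thesis by blast
qed

lemma (in prob_space) ba_density:
  assumes "\<nu> \<in> ba M" "sigma_additive M \<nu>"
  shows "integrable M (ba_density M \<nu>)" "\<And>A. A \<in> sets M \<Longrightarrow> \<nu> A = (LINT \<omega>:A|M. ba_density M \<nu> \<omega>)"
proof -
  have "\<exists>Y. Y \<in> L1 M \<and> (\<forall>A\<in>sets M. \<nu> A = (LINT \<omega>:A|M. Y \<omega>))"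
    using sigma_additive_density[OF assms] by blast
  from someI_ex[OF this, folded ba_density_def]
  show "integrable M (ba_density M \<nu>)" "\<And>A. A \<in> sets M \<Longrightarrow> \<nu> A = (LINT \<omega>:A|M. ba_density M \<nu> \<omega>)"
    by (auto simp: L1_def)
qed

lemma Linf_mult_integrable:
  fixes Y :: "'a \<Rightarrow> real"
  assumes "X \<in> Linf M" "integrable M Y"
  shows "integrable M (\<lambda>\<omega>. X \<omega> * Y \<omega>)"
proof -
  obtain C where C: "AE \<omega> in M. \<bar>X \<omega>\<bar> \<le> C" and [measurable]: "X \<in> borel_measurable M" using assms(1) by (auto simp: Linf_def)
  have [measurable]: "Y \<in> borel_measurable M" using assms(2) by simp
  show ?thesis
  proof (rule Bochner_Integration.integrable_bound)
    show "integrable M (\<lambda>\<omega>. C * Y \<omega>)" using assms(2) by simp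
    show "AE \<omega> in M. norm (X \<omega> * Y \<omega>) \<le> norm (C * Y \<omega>)"
      using C by eventually_elim (auto simp: abs_mult intro!: mult_right_mono)
  qed simp
qed

text \<open>Both sides agree on simple functions by additivity, and both are continuous under
  uniform convergence up to null sets, the right-hand one because the density is integrable.\<close>

lemma (in prob_space) ba_integral_eq_LINT:
  assumes nu: "\<nu> \<in> ba M" and sa: "sigma_additive M \<nu>" and X: "X \<in> Linf M"
  shows "ba_integral M \<nu> X = (LINT \<omega>|M. X \<omega> * ba_density M \<nu> \<omega>)"
proof -
  let ?Y = "ba_density M \<nu>"
  note Y = ba_density[OF nu sa]
  obtain s where s: "\<And>n. simple_function M (s n)" "Linf_tendsto M s X"
    using Linf_simple_approx_tendsto[OF X] by blast
  have simp_int: "integrable M (\<lambda>\<omega>. w \<omega> * ?Y \<omega>) \<and> simple_ba_integral M \<nu> w = (LINT \<omega>|M. w \<omega> * ?Y \<omega>)"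
    if w: "simple_function M w" for w
  proof -
    have fin: "finite (w ` space M)" using w by (simp add: simple_function_def)
    have ms: "w -` {v} \<inter> space M \<in> sets M" for v using w by (rule simple_functionD)
    have i: "integrable M (\<lambda>\<omega>. v * (indicator (w -` {v} \<inter> space M) \<omega> * ?Y \<omega>))" for v
      using Y(1) ms integrable_mult_indicator[OF ms Y(1)] by simp
    have eq: "w \<omega> * ?Y \<omega> = (\<Sum>v\<in>w ` space M. v * (indicator (w -` {v} \<inter> space M) \<omega> * ?Y \<omega>))" if "\<omega> \<in> space M" for \<omega>
      using that fin by (subst sum.remove[of _ "w \<omega>"]) (auto intro!: sum.neutral)
    have "integrable M (\<lambda>\<omega>. w \<omega> * ?Y \<omega>)"
      by (subst Bochner_Integration.integrable_cong[OF refl eq]) (use i in auto)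
    moreover have "(LINT \<omega>|M. w \<omega> * ?Y \<omega>) = (\<Sum>v\<in>w ` space M. v * \<nu> (w -` {v} \<inter> space M))"
      by (subst Bochner_Integration.integral_cong[OF refl eq])
         (use i Y(2)[OF ms] in \<open>auto simp: set_lebesgue_integral_def\<close>)
    ultimately show ?thesis by (simp add: simple_ba_integral_def)
  qed
  have "(\<lambda>n. LINT \<omega>|M. s n \<omega> * ?Y \<omega>) \<longlonglongrightarrow> (LINT \<omega>|M. X \<omega> * ?Y \<omega>)"
  proof (rule LIMSEQ_I)
    fix r :: real assume r: "r > 0"
    define K where "K = (LINT \<omega>|M. \<bar>?Y \<omega>\<bar>)"
    have K: "K \<ge> 0" by (simp add: K_def)
    have "r / (K + 1) > 0" using r K by simp
    then have "\<forall>\<^sub>F n in sequentially. AE \<omega> in M. \<bar>s n \<omega> - X \<omega>\<bar> \<le> r / (K + 1)"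
      using s(2) unfolding Linf_tendsto_def by blast
    then have "\<forall>\<^sub>F n in sequentially. norm ((LINT \<omega>|M. s n \<omega> * ?Y \<omega>) - (LINT \<omega>|M. X \<omega> * ?Y \<omega>)) < r"
    proof eventually_elim
      case (elim n)
      have i: "integrable M (\<lambda>\<omega>. s n \<omega> * ?Y \<omega>)" "integrable M (\<lambda>\<omega>. X \<omega> * ?Y \<omega>)"
        using simp_int[OF s(1)] Linf_mult_integrable[OF X Y(1)] by auto
      have "norm ((LINT \<omega>|M. s n \<omega> * ?Y \<omega>) - (LINT \<omega>|M. X \<omega> * ?Y \<omega>)) = norm (LINT \<omega>|M. s n \<omega> * ?Y \<omega> - X \<omega> * ?Y \<omega>)"
        using i by simp
      also have "\<dots> \<le> (LINT \<omega>|M. norm (s n \<omega> * ?Y \<omega> - X \<omega> * ?Y \<omega>))"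
        by (rule integral_norm_bound)
      also have "\<dots> \<le> (LINT \<omega>|M. r / (K + 1) * \<bar>?Y \<omega>\<bar>)"
      proof (rule integral_mono_AE)
        have "AE \<omega> in M. norm (s n \<omega> * ?Y \<omega> - X \<omega> * ?Y \<omega>) \<le> r / (K + 1) * \<bar>?Y \<omega>\<bar>"
          using elim
        proof eventually_elim
          case (elim \<omega>)
          have "norm (s n \<omega> * ?Y \<omega> - X \<omega> * ?Y \<omega>) = \<bar>s n \<omega> - X \<omega>\<bar> * \<bar>?Y \<omega>\<bar>"
            by (simp add: abs_mult flip: left_diff_distrib)
          then show ?case using mult_right_mono[OF elim, of "\<bar>?Y \<omega>\<bar>"] by simp
        qed
        then show "AE \<omega> in M. norm (s n \<omega> * ?Y \<omega> - X \<omega> * ?Y \<omega>) \<le> r / (K + 1) * \<bar>?Y \<omega>\<bar>" .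
      qed (use i Y in auto)
      also have "\<dots> = r * (K / (K + 1))" by (simp add: K_def)
      also have "\<dots> < r * 1" using r K by (intro mult_strict_left_mono) (auto simp: field_simps)
      finally show ?case by simp
    qed
    then show "\<exists>no. \<forall>n\<ge>no. norm ((LINT \<omega>|M. s n \<omega> * ?Y \<omega>) - (LINT \<omega>|M. X \<omega> * ?Y \<omega>)) < r"
      by (simp add: eventually_sequentially)
  qed
  moreover have "(\<lambda>n. LINT \<omega>|M. s n \<omega> * ?Y \<omega>) \<longlonglongrightarrow> ba_integral M \<nu> X"
    using ba_integral_LIMSEQ[OF nu X s] simp_int[OF s(1)] by simp
  ultimately show ?thesis by (metis LIMSEQ_unique)
qed

section \<open>The minimax theorem\<close>

text \<open>Fan's substitute for convexity in the absence of a linear structure: measures are mere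
  indices here, and their densities mix only almost everywhere. One mixing point \<open>r\<close>
  must serve all \<open>x\<close> at once.\<close>

definition convexlike :: "'p set \<Rightarrow> 'x set \<Rightarrow> ('p \<Rightarrow> 'x \<Rightarrow> real) \<Rightarrow> bool" where
  "convexlike K S \<phi> \<longleftrightarrow> (\<forall>p\<in>K. \<forall>q\<in>K. \<forall>t\<in>{0..1}. \<exists>r\<in>K. \<forall>x\<in>S. \<phi> r x \<le> t * \<phi> p x + (1 - t) * \<phi> q x)"

definition concavelike :: "'p set \<Rightarrow> 'x set \<Rightarrow> ('p \<Rightarrow> 'x \<Rightarrow> real) \<Rightarrow> bool" where
  "concavelike K S \<phi> \<longleftrightarrow> (\<forall>x\<in>S. \<forall>y\<in>S. \<forall>t\<in>{0..1}. \<exists>z\<in>S. \<forall>p\<in>K. t * \<phi> p x + (1 - t) * \<phi> p y \<le> \<phi> p z)"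

lemma alternative_two_functions:
  fixes a b :: "'p \<Rightarrow> real"
  assumes conv: "\<And>p q t. p \<in> K \<Longrightarrow> q \<in> K \<Longrightarrow> 0 \<le> t \<Longrightarrow> t \<le> 1 \<Longrightarrow>
      \<exists>r\<in>K. a r \<le> t * a p + (1 - t) * a q \<and> b r \<le> t * b p + (1 - t) * b q"
    and max: "\<And>p. p \<in> K \<Longrightarrow> c < a p \<or> c < b p"
  shows "\<exists>t. 0 \<le> t \<and> t \<le> 1 \<and> (\<forall>p\<in>K. c \<le> t * a p + (1 - t) * b p)"
proof -
  text \<open>\<open>L p\<close> is the weight at which the combination of \<open>a p\<close> and \<open>b p\<close> equals \<open>c\<close>. It
    bounds \<open>t\<close> from below if \<open>b p \<le> c\<close> and from above if \<open>a p \<le> c\<close>. Two contradictory bounds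
    would give a mixture at which both functions are at most \<open>c\<close>.\<close>
  define L where "L p = (c - b p) / (a p - b p)" for p
  let ?A = "{p \<in> K. a p > c \<and> b p \<le> c}" and ?B = "{p \<in> K. a p \<le> c \<and> b p > c}"
  have key: "L p \<le> L q" if "p \<in> ?A" "q \<in> ?B" for p q
  proof (rule ccontr)
    assume "\<not> L p \<le> L q"
    define u v u' v' where "u = a p - c" and "v = c - b p" and "u' = c - a q" and "v' = b q - c"
    have pos: "u > 0" "v \<ge> 0" "u' \<ge> 0" "v' > 0" using that by (auto simp: u_def v_def u'_def v'_def)
    have "L p = v / (u + v)" by (simp add: L_def u_def v_def)
    moreover have "L q = v' / (u' + v')"
      by (simp add: L_def u'_def v'_def) (metis minus_diff_eq minus_divide_divide)
    ultimately have "v' / (u' + v') < v / (u + v)" using \<open>\<not> L p \<le> L q\<close> by simp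
    then have "v' * (u + v) < v * (u' + v')"
      using pos by (simp add: divide_less_eq less_divide_eq field_simps split: if_splits)
    then have lt: "u * v' < u' * v" by (simp add: algebra_simps)
    \<comment> \<open>The weight at which the mixture of \<open>a p\<close> and \<open>a q\<close>
      is exactly \<open>c\<close>; the sign of \<open>u * v' - u' * v\<close> then decides on which
      side of \<open>c\<close> the mixture of \<open>b p\<close> and \<open>b q\<close>
      lies.\<close>
    define t where "t = u' / (u + u')"
    have t: "0 \<le> t" "t \<le> 1" "1 - t = u / (u + u')" using pos by (auto simp: t_def field_simps)
    from conv[OF _ _ t(1,2), of p q] that obtain r where r: "r \<in> K"
      "a r \<le> t * a p + (1 - t) * a q" "b r \<le> t * b p + (1 - t) * b q" by auto
    have "t * a p + (1 - t) * a q = c + (t * u - (1 - t) * u')" by (simp add: u_def u'_def algebra_simps)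
    also have "t * u - (1 - t) * u' = 0" unfolding t(3) unfolding t_def by (simp add: field_simps)
    finally have 1: "a r \<le> c" using r by simp
    have "t * b p + (1 - t) * b q = c + ((1 - t) * v' - t * v)" by (simp add: v_def v'_def algebra_simps)
    also have "(1 - t) * v' - t * v = (u * v' - u' * v) / (u + u')" unfolding t(3) unfolding t_def by (simp add: diff_divide_distrib)
    also have "\<dots> \<le> 0" using lt pos by (intro divide_nonpos_pos) auto
    finally have "b r \<le> c" using r by simp
    with 1 max[OF r(1)] show False by auto
  qed
  have L01: "0 \<le> L p \<and> L p \<le> 1" if "p \<in> ?A \<union> ?B" for p
    using that by (auto simp: L_def divide_le_eq_1 zero_le_divide_iff)
  obtain t where t: "0 \<le> t" "t \<le> 1" "\<And>p. p \<in> ?A \<Longrightarrow> L p \<le> t" "\<And>q. q \<in> ?B \<Longrightarrow> t \<le> L q"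
  proof (cases "?A = {}")
    case True
    show ?thesis by (rule that[of 0]) (use True L01 in auto)
  next
    case False
    have bdd: "bdd_above (L ` ?A)" using L01 by (intro bdd_aboveI2[of _ _ 1]) auto
    show ?thesis
    proof (rule that[of "SUP p\<in>?A. L p"])
      show "0 \<le> (SUP p\<in>?A. L p)" using False L01 bdd by (meson UnCI cSUP_upper2 ex_in_conv)
      show "(SUP p\<in>?A. L p) \<le> 1" using False L01 by (intro cSUP_least) auto
      show "L p \<le> (SUP p\<in>?A. L p)" if "p \<in> ?A" for p using bdd that by (rule cSUP_upper2) auto
      show "(SUP p\<in>?A. L p) \<le> L q" if "q \<in> ?B" for q using False key that by (intro cSUP_least) auto
    qed
  qed
  have "c \<le> t * a p + (1 - t) * b p" if p: "p \<in> K" for p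
  proof -
    consider "p \<in> ?A" | "p \<in> ?B" | "a p > c" "b p > c" using max[OF p] p by force
    then show ?thesis
    proof cases
      case 1
      then have "c - b p \<le> t * (a p - b p)" using t(3)[OF 1] by (auto simp: L_def divide_le_eq)
      then show ?thesis by (simp add: algebra_simps)
    next
      case 2
      then have "c - b p \<le> t * (a p - b p)" using t(4)[OF 2] by (auto simp: L_def le_divide_eq)
      then show ?thesis by (simp add: algebra_simps)
    next
      case 3
      then have "t * c + (1 - t) * c \<le> t * a p + (1 - t) * b p"
        using t by (intro add_mono mult_left_mono) auto
      then show ?thesis by (simp add: algebra_simps)
    qed
  qed
  with t show ?thesis by blast
qed

text \<open>Induction on the finite family. The points where the new \<open>x\<close> fails form
  \<open>K'\<close>, again closed under mixing, and there \<open>F\<close> alone suffices, so some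
  \<open>y\<close> is good on \<open>K'\<close>. At every point of \<open>K\<close> one of
  \<open>x\<close> and \<open>y\<close> is good, and \<open>alternative_two_functions\<close> merges
  them into one mixture. As that lemma turns a strict bound into a weak one, each step gives up some
  of the slack between \<open>d\<close> and \<open>c\<close>.\<close>

lemma Kneser_Fan_minimax:
  fixes \<phi> :: "'p \<Rightarrow> 'x \<Rightarrow> real"
  assumes "finite F" "F \<subseteq> S" "S \<noteq> {}" "convexlike K S \<phi>" "concavelike K S \<phi>"
    and "\<And>p. p \<in> K \<Longrightarrow> \<exists>x\<in>F. c < \<phi> p x" and "d < c"
  shows "\<exists>x\<in>S. \<forall>p\<in>K. d \<le> \<phi> p x"
  using assms
proof (induction F arbitrary: K c d rule: finite_induct)
  case empty
  from empty.prems(5) have "K = {}" by blast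
  with empty.prems(2) show ?case by blast
next
  case (insert x F)
  define K' where "K' = {p \<in> K. \<phi> p x \<le> c}"
  have "convexlike K' S \<phi>"
    unfolding convexlike_def
  proof (intro ballI)
    fix p q t assume pq: "p \<in> K'" "q \<in> K'" "t \<in> {0..1::real}"
    then obtain r where r: "r \<in> K" "\<forall>x\<in>S. \<phi> r x \<le> t * \<phi> p x + (1 - t) * \<phi> q x"
      using insert.prems(3) by (force simp: convexlike_def K'_def)
    have "t * \<phi> p x + (1 - t) * \<phi> q x \<le> t * c + (1 - t) * c"
      using pq by (intro add_mono mult_left_mono) (auto simp: K'_def)
    then have "\<phi> r x \<le> c" using r insert.prems(1) by (force simp: algebra_simps)
    with r show "\<exists>r\<in>K'. \<forall>x\<in>S. \<phi> r x \<le> t * \<phi> p x + (1 - t) * \<phi> q x" by (auto simp: K'_def)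
  qed
  moreover have "concavelike K' S \<phi>"
    using insert.prems(4) unfolding concavelike_def K'_def by fast
  moreover have "\<exists>x\<in>F. c < \<phi> p x" if "p \<in> K'" for p using insert.prems(5)[of p] that by (force simp: K'_def)
  \<comment> \<open>The midpoint leaves room on both sides: \<open>e < c\<close> for the induction
    hypothesis, \<open>d < e\<close> for the strict alternative.\<close>
  moreover define e where "e = (c + d) / 2"
  moreover have "e < c" using insert.prems(6) by (simp add: e_def)
  ultimately obtain y where y: "y \<in> S" "\<forall>p\<in>K'. e \<le> \<phi> p y"
    using insert.IH[of K' c e] insert.prems(1,2) by blast
  have "\<exists>t. 0 \<le> t \<and> t \<le> 1 \<and> (\<forall>p\<in>K. d \<le> t * \<phi> p x + (1 - t) * \<phi> p y)"
  proof (rule alternative_two_functions)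
    show "d < \<phi> p x \<or> d < \<phi> p y" if "p \<in> K" for p
      using y that insert.prems(6) unfolding K'_def e_def by force
    show "\<exists>r\<in>K. \<phi> r x \<le> t * \<phi> p x + (1 - t) * \<phi> q x \<and> \<phi> r y \<le> t * \<phi> p y + (1 - t) * \<phi> q y"
      if "p \<in> K" "q \<in> K" "0 \<le> t" "t \<le> 1" for p q t
    proof -
      have "t \<in> {0..1}" using that by simp
      with that obtain r where "r \<in> K" "\<forall>x\<in>S. \<phi> r x \<le> t * \<phi> p x + (1 - t) * \<phi> q x"
        using insert.prems(3) unfolding convexlike_def by blast
      then show ?thesis using y insert.prems(1) by auto
    qed
  qed
  then obtain t where t: "t \<in> {0..1}" "\<forall>p\<in>K. d \<le> t * \<phi> p x + (1 - t) * \<phi> p y" by auto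
  then obtain z where "z \<in> S" "\<forall>p\<in>K. t * \<phi> p x + (1 - t) * \<phi> p y \<le> \<phi> p z"
    using insert.prems(1,4) y(1) unfolding concavelike_def by blast
  with t show ?case by (meson order_trans)
qed

section \<open>Extended expectations and the weak topology\<close>

lemma continuous_map_weak_L1:
  assumes "W \<in> Linf M"
  shows "continuous_map (weak_L1 M) euclideanreal (\<lambda>Y. LINT \<omega>|M. W \<omega> * Y \<omega>)"
proof -
  have "continuous_map (weak_L1 M) euclideanreal ((\<lambda>g. g W) \<circ> (\<lambda>Y. \<lambda>X\<in>Linf M. LINT \<omega>|M. X \<omega> * Y \<omega>))"
    unfolding weak_L1_def using assms
    by (intro continuous_map_pullback continuous_map_product_projection)
  then show ?thesis using assms by (simp add: comp_def)
qed

lemma ext_expectation_mono: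
  assumes "AE \<omega> in M. g \<omega> \<le> h \<omega>"
  shows "ext_expectation M g \<le> ext_expectation M h"
  unfolding ext_expectation_def
  by (intro ereal_minus_mono less_eq_ennreal.rep_eq[THEN iffD1] nn_integral_mono_AE;
      use assms in eventually_elim; auto intro!: e2ennreal_mono max.mono)

lemma ext_expectation_cong_AE:
  assumes "AE \<omega> in M. g \<omega> = h \<omega>"
  shows "ext_expectation M g = ext_expectation M h"
  using assms by (intro antisym ext_expectation_mono; eventually_elim; simp)

lemma ext_expectation_integrable:
  fixes h :: "'a \<Rightarrow> real"
  assumes "integrable M h"
  shows "ext_expectation M (\<lambda>\<omega>. ereal (h \<omega>)) = ereal (LINT \<omega>|M. h \<omega>)"
proof -
  have p: "(\<integral>\<^sup>+\<omega>. e2ennreal (max 0 (ereal (w \<omega>))) \<partial>M) = ennreal (LINT \<omega>|M. max 0 (w \<omega>))"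
    if "integrable M w" for w :: "'a \<Rightarrow> real"
  proof -
    have "e2ennreal (max 0 (ereal (w \<omega>))) = ennreal (max 0 (w \<omega>))" for \<omega>
      by (cases "0 \<le> w \<omega>") (auto simp: max_def e2ennreal_ereal e2ennreal_neg)
    then show ?thesis using that nn_integral_eq_integral[of M "\<lambda>\<omega>. max 0 (w \<omega>)"] by simp
  qed
  have "ext_expectation M (\<lambda>\<omega>. ereal (h \<omega>)) =
      ereal (LINT \<omega>|M. max 0 (h \<omega>)) - ereal (LINT \<omega>|M. max 0 (- h \<omega>))"
    unfolding ext_expectation_def using p[OF assms] p[of "\<lambda>\<omega>. - h \<omega>"] assms by simp
  also have "\<dots> = ereal (LINT \<omega>|M. max 0 (h \<omega>) - max 0 (- h \<omega>))" using assms by simp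
  also have "(\<lambda>\<omega>. max 0 (h \<omega>) - max 0 (- h \<omega>)) = h" by auto
  finally show ?thesis .
qed

text \<open>Meant for envelopes: \<open>u\<close> is an uncountable supremum that enters through a
  pointwise bound only, \<open>h\<close> the integrand at a starting function, and \<open>g\<close>
  the total gain over it, which monotone convergence controls.\<close>

lemma ext_expectation_le_add:
  assumes le: "AE \<omega> in M. u \<omega> \<le> ereal (h \<omega>) + enn2ereal (g \<omega>)"
    and h: "integrable M h" and g: "g \<in> borel_measurable M" "(\<integral>\<^sup>+\<omega>. g \<omega> \<partial>M) \<le> ennreal d" and d: "0 \<le> d"
  shows "ext_expectation M u \<le> ereal ((LINT \<omega>|M. h \<omega>) + d)"
proof -
  have fin: "(\<integral>\<^sup>+\<omega>. g \<omega> \<partial>M) \<noteq> \<infinity>" using g(2) by (auto simp: top_unique)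
  then have gr: "AE \<omega> in M. g \<omega> = ennreal (enn2real (g \<omega>))"
    using nn_integral_PInf_AE[OF g(1)] by (auto simp: less_top elim!: eventually_mono)
  then have nn: "(\<integral>\<^sup>+\<omega>. ennreal (enn2real (g \<omega>)) \<partial>M) = (\<integral>\<^sup>+\<omega>. g \<omega> \<partial>M)"
    by (intro nn_integral_cong_AE) (auto elim!: eventually_mono)
  have int: "integrable M (\<lambda>\<omega>. enn2real (g \<omega>))"
    using g(1) fin nn by (intro integrableI_nonneg) (auto simp: less_top)
  have "AE \<omega> in M. u \<omega> \<le> ereal (h \<omega> + enn2real (g \<omega>))"
    using le gr
  proof eventually_elim
    case (elim \<omega>)
    have "enn2ereal (g \<omega>) = ereal (enn2real (g \<omega>))"
      by (subst elim(2)) simp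
    with elim(1) show ?case by simp
  qed
  then have "ext_expectation M u \<le> ext_expectation M (\<lambda>\<omega>. ereal (h \<omega> + enn2real (g \<omega>)))"
    by (rule ext_expectation_mono)
  also have "\<dots> = ereal ((LINT \<omega>|M. h \<omega>) + (LINT \<omega>|M. enn2real (g \<omega>)))"
    using h int by (subst ext_expectation_integrable) auto
  also have "(LINT \<omega>|M. enn2real (g \<omega>)) \<le> d"
    using g(2) d int nn[symmetric] by (simp add: nn_integral_eq_integral)
  finally show ?thesis by simp
qed

lemma Linf_D: "X \<in> Linf M \<Longrightarrow> X \<in> borel_measurable M"
  by (simp add: Linf_def)

lemma Linf_I: "X \<in> borel_measurable M \<Longrightarrow> AE \<omega> in M. \<bar>X \<omega>\<bar> \<le> C \<Longrightarrow> X \<in> Linf M"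
  by (auto simp: Linf_def)

section \<open>Duality for real-valued integrands\<close>

text \<open>Expectations under \<open>P\<close> become integrals against the density
  \<open>Z P\<close> under the single measure \<open>M\<close>, where the weak topology lives.
  \<open>minorant\<close> is the Fenchel inequality for one admissible \<open>Y\<close> per
  \<open>P\<close>, with the integrable positive part of \<open>ftilde\<close> as
  \<open>G\<close>.\<close>

locale robust_integrand = prob_space M for M :: "'a measure" +
  fixes \<P> :: "'p set" and Z :: "'p \<Rightarrow> 'a \<Rightarrow> real" and F :: "'a \<Rightarrow> real \<Rightarrow> real"
  assumes Z_integrable: "\<And>P. P \<in> \<P> \<Longrightarrow> integrable M (Z P)"
    and Z_nonneg: "\<And>P \<omega>. 0 \<le> Z P \<omega>"
    and F_measurable: "\<And>X. X \<in> borel_measurable M \<Longrightarrow> (\<lambda>\<omega>. F \<omega> (X \<omega>)) \<in> borel_measurable M"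
    and F_convex: "AE \<omega> in M. convex_on UNIV (F \<omega>)"
    and Z_convex: "\<And>P Q t. P \<in> \<P> \<Longrightarrow> Q \<in> \<P> \<Longrightarrow> 0 \<le> t \<Longrightarrow> t \<le> 1 \<Longrightarrow>
      \<exists>R\<in>\<P>. AE \<omega> in M. Z R \<omega> = t * Z P \<omega> + (1 - t) * Z Q \<omega>"
    and Z_compact: "compactin (weak_L1 M) (Z ` \<P>)"
    and minorant: "\<And>P. P \<in> \<P> \<Longrightarrow> \<exists>Y G. integrable M Y \<and> integrable M G \<and>
      (AE \<omega> in M. \<forall>x. x * Y \<omega> - G \<omega> \<le> Z P \<omega> * F \<omega> x)"
begin

lemma F_convex_comb:
  "AE \<omega> in M. \<forall>x y. \<forall>t\<in>{0..1}. F \<omega> (t * x + (1 - t) * y) \<le> t * F \<omega> x + (1 - t) * F \<omega> y"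
  using F_convex
proof eventually_elim
  case (elim \<omega>)
  show ?case
  proof (intro allI ballI)
    fix x y t :: real assume "t \<in> {0..1}"
    then show "F \<omega> (t * x + (1 - t) * y) \<le> t * F \<omega> x + (1 - t) * F \<omega> y"
      using convex_onD[OF elim, of t y x] by (simp add: algebra_simps)
  qed
qed

text \<open>Along a bounded \<open>X\<close> the minorant is an integrable lower bound, so an
  integrable upper bound is all that has to be supplied.\<close>

lemma ZF_integrable:
  assumes P: "P \<in> \<P>" and X: "X \<in> Linf M" and U: "integrable M U" "AE \<omega> in M. Z P \<omega> * F \<omega> (X \<omega>) \<le> U \<omega>"
  shows "integrable M (\<lambda>\<omega>. Z P \<omega> * F \<omega> (X \<omega>))"
proof -
  obtain Y G where YG: "integrable M Y" "integrable M G" "AE \<omega> in M. \<forall>x. x * Y \<omega> - G \<omega> \<le> Z P \<omega> * F \<omega> x"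
    using minorant[OF P] by blast
  note [measurable] = F_measurable[OF Linf_D[OF X]] borel_measurable_integrable[OF Z_integrable[OF P]]
  show ?thesis
  proof (rule Bochner_Integration.integrable_bound)
    show "integrable M (\<lambda>\<omega>. \<bar>U \<omega>\<bar> + \<bar>X \<omega> * Y \<omega> - G \<omega>\<bar>)"
      using U YG Linf_mult_integrable[OF X YG(1)] by auto
    show "AE \<omega> in M. norm (Z P \<omega> * F \<omega> (X \<omega>)) \<le> norm (\<bar>U \<omega>\<bar> + \<bar>X \<omega> * Y \<omega> - G \<omega>\<bar>)"
      using U(2) YG(3)
    proof eventually_elim
      case (elim \<omega>)
      then have "X \<omega> * Y \<omega> - G \<omega> \<le> Z P \<omega> * F \<omega> (X \<omega>)" by blast
      with elim(1) show ?case by simp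
    qed
  qed measurable
qed

end

text \<open>\<open>A\<close> stands for sets ignored by the singular part, cut down to where
  \<open>F\<close> along \<open>X0\<close> is bounded above. \<open>X0_tail\<close> expresses
  uniform integrability through the excess over a level \<open>j\<close>, because this excess is
  what truncation at \<open>j\<close> leaves behind.\<close>

locale robust_duality = robust_integrand M \<P> Z F
  for M :: "'a measure" and \<P> :: "'p set" and Z F +
  fixes X0 Y :: "'a \<Rightarrow> real" and A :: "nat \<Rightarrow> 'a set"
  assumes X0: "X0 \<in> Linf M" and Y: "integrable M Y"
    and X0_integrable: "\<And>P. P \<in> \<P> \<Longrightarrow> integrable M (\<lambda>\<omega>. Z P \<omega> * max 0 (F \<omega> (X0 \<omega>)))"
    and X0_tail: "\<And>e::real. e > 0 \<Longrightarrow> \<exists>j0. \<forall>j\<ge>j0. \<forall>P\<in>\<P>. (LINT \<omega>|M. Z P \<omega> * max 0 (F \<omega> (X0 \<omega>) - j)) \<le> e"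
    and A_sets: "\<And>n. A n \<in> sets M" and A_incseq: "incseq A"
    and A_cover: "AE \<omega> in M. \<exists>n. \<omega> \<in> A n"
    and A_bound: "\<And>n \<omega>. \<omega> \<in> A n \<Longrightarrow> F \<omega> (X0 \<omega>) \<le> real n"
begin

text \<open>The bound on \<open>A n\<close> is one-sided, which keeps the set convex. It reduces the uniform integrability of
  the competitors to that of \<open>X0\<close>, so that none is needed for the densities themselves.\<close>

definition competitors :: "('a \<Rightarrow> real) set" where
  "competitors = {X \<in> Linf M. \<exists>n k. (AE \<omega> in M. \<omega> \<in> A n \<longrightarrow> F \<omega> (X \<omega>) \<le> k) \<and>
     (\<forall>\<omega>\<in>space M - A n. X \<omega> = X0 \<omega>)}"

definition gap :: "'p \<Rightarrow> ('a \<Rightarrow> real) \<Rightarrow> real" where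
  "gap P X = (LINT \<omega>|M. X \<omega> * Y \<omega>) - (LINT \<omega>|M. Z P \<omega> * F \<omega> (X \<omega>))"

lemma competitors_Linf: "X \<in> competitors \<Longrightarrow> X \<in> Linf M"
  by (simp add: competitors_def)

lemma X0_competitor: "X0 \<in> competitors"
  using X0 A_bound[of _ 0] by (auto simp: competitors_def intro!: exI[of _ "0::nat"] exI[of _ "0::real"])

text \<open>Lets several competitors share one \<open>n\<close> and \<open>k\<close>. Enlarging
  \<open>n\<close> adds points where \<open>X\<close> equals \<open>X0\<close>, and there the bound
  is \<open>n\<close> by \<open>A_bound\<close>; hence the requirement
  \<open>real n \<le> k\<close>.\<close>

lemma competitorE:
  assumes "X \<in> competitors"
  obtains N K where "\<And>n k. N \<le> n \<Longrightarrow> K \<le> k \<Longrightarrow> real n \<le> k \<Longrightarrow>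
    (AE \<omega> in M. \<omega> \<in> A n \<longrightarrow> F \<omega> (X \<omega>) \<le> k) \<and> (\<forall>\<omega>\<in>space M - A n. X \<omega> = X0 \<omega>)"
proof -
  from assms obtain N K where *: "AE \<omega> in M. \<omega> \<in> A N \<longrightarrow> F \<omega> (X \<omega>) \<le> K" "\<And>\<omega>. \<omega> \<in> space M - A N \<Longrightarrow> X \<omega> = X0 \<omega>"
    by (auto simp: competitors_def)
  show thesis
  proof (rule that, intro conjI)
    fix n k assume nk: "N \<le> n" "K \<le> k" "real n \<le> k"
    show "AE \<omega> in M. \<omega> \<in> A n \<longrightarrow> F \<omega> (X \<omega>) \<le> k"
      using *(1) AE_space
    proof eventually_elim
      case (elim \<omega>)
      then show ?case using *(2)[of \<omega>] A_bound[of \<omega> n] nk by (cases "\<omega> \<in> A N") auto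
    qed
    show "\<forall>\<omega>\<in>space M - A n. X \<omega> = X0 \<omega>" using *(2) incseqD[OF A_incseq nk(1)] by auto
  qed
qed

lemma competitors_convex:
  assumes X: "X \<in> competitors" "X' \<in> competitors" and t: "t \<in> {0..1}"
  shows "(\<lambda>\<omega>. t * X \<omega> + (1 - t) * X' \<omega>) \<in> competitors"
proof -
  obtain N K where 1: "\<And>n k. N \<le> n \<Longrightarrow> K \<le> k \<Longrightarrow> real n \<le> k \<Longrightarrow>
    (AE \<omega> in M. \<omega> \<in> A n \<longrightarrow> F \<omega> (X \<omega>) \<le> k) \<and> (\<forall>\<omega>\<in>space M - A n. X \<omega> = X0 \<omega>)"
    using competitorE[OF X(1)] by blast
  obtain N' K' where 2: "\<And>n k. N' \<le> n \<Longrightarrow> K' \<le> k \<Longrightarrow> real n \<le> k \<Longrightarrow>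
    (AE \<omega> in M. \<omega> \<in> A n \<longrightarrow> F \<omega> (X' \<omega>) \<le> k) \<and> (\<forall>\<omega>\<in>space M - A n. X' \<omega> = X0 \<omega>)"
    using competitorE[OF X(2)] by blast
  define n where "n = max N N'"
  define k where "k = max (max K K') (real n)"
  have 3: "AE \<omega> in M. \<omega> \<in> A n \<longrightarrow> F \<omega> (X \<omega>) \<le> k" "\<forall>\<omega>\<in>space M - A n. X \<omega> = X0 \<omega>"
    "AE \<omega> in M. \<omega> \<in> A n \<longrightarrow> F \<omega> (X' \<omega>) \<le> k" "\<forall>\<omega>\<in>space M - A n. X' \<omega> = X0 \<omega>"
    using 1[of n k] 2[of n k] by (auto simp: n_def k_def)
  have "AE \<omega> in M. \<omega> \<in> A n \<longrightarrow> F \<omega> (t * X \<omega> + (1 - t) * X' \<omega>) \<le> k"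
    using 3(1) 3(3) F_convex_comb
  proof eventually_elim
    case (elim \<omega>)
    show ?case
    proof
      assume "\<omega> \<in> A n"
      then have "t * F \<omega> (X \<omega>) + (1 - t) * F \<omega> (X' \<omega>) \<le> t * k + (1 - t) * k"
        using elim t by (intro add_mono mult_left_mono) auto
      moreover have "F \<omega> (t * X \<omega> + (1 - t) * X' \<omega>) \<le> t * F \<omega> (X \<omega>) + (1 - t) * F \<omega> (X' \<omega>)"
        using elim(3) t by blast
      ultimately show "F \<omega> (t * X \<omega> + (1 - t) * X' \<omega>) \<le> k" by (simp add: algebra_simps)
    qed
  qed
  moreover have "\<forall>\<omega>\<in>space M - A n. t * X \<omega> + (1 - t) * X' \<omega> = X0 \<omega>"
    using 3 by (auto simp: algebra_simps)
  moreover have "(\<lambda>\<omega>. t * X \<omega> + (1 - t) * X' \<omega>) \<in> Linf M"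
  proof -
    obtain C C' where C: "AE \<omega> in M. \<bar>X \<omega>\<bar> \<le> C" "AE \<omega> in M. \<bar>X' \<omega>\<bar> \<le> C'"
      using X by (auto simp: competitors_def Linf_def)
    note [measurable] = X[THEN competitors_Linf, THEN Linf_D]
    show ?thesis
    proof (rule Linf_I[where C="C + C'"])
      show "AE \<omega> in M. \<bar>t * X \<omega> + (1 - t) * X' \<omega>\<bar> \<le> C + C'"
        using C
      proof eventually_elim
        case (elim \<omega>)
        have "\<bar>t * X \<omega>\<bar> \<le> 1 * \<bar>X \<omega>\<bar>" "\<bar>(1 - t) * X' \<omega>\<bar> \<le> 1 * \<bar>X' \<omega>\<bar>"
          unfolding abs_mult using t by (intro mult_right_mono; auto)+
        with elim show ?case by linarith
      qed
    qed measurable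
  qed
  ultimately show ?thesis unfolding competitors_def by blast
qed

lemma competitor_integrable:
  assumes P: "P \<in> \<P>" and X: "X \<in> competitors"
  shows "integrable M (\<lambda>\<omega>. Z P \<omega> * F \<omega> (X \<omega>))"
proof -
  obtain n k where nk: "AE \<omega> in M. \<omega> \<in> A n \<longrightarrow> F \<omega> (X \<omega>) \<le> k" "\<forall>\<omega>\<in>space M - A n. X \<omega> = X0 \<omega>"
    using X by (auto simp: competitors_def)
  have "AE \<omega> in M. Z P \<omega> * F \<omega> (X \<omega>) \<le> Z P \<omega> * \<bar>k\<bar> + Z P \<omega> * max 0 (F \<omega> (X0 \<omega>))"
    using nk(1) AE_space
  proof eventually_elim
    case (elim \<omega>)
    then have "F \<omega> (X \<omega>) \<le> \<bar>k\<bar> + max 0 (F \<omega> (X0 \<omega>))" using nk(2) by (cases "\<omega> \<in> A n") auto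
    from mult_left_mono[OF this Z_nonneg[of P \<omega>]] show ?case by (simp add: distrib_left)
  qed
  moreover have "integrable M (\<lambda>\<omega>. Z P \<omega> * \<bar>k\<bar> + Z P \<omega> * max 0 (F \<omega> (X0 \<omega>)))"
    using Z_integrable[OF P] X0_integrable[OF P] by auto
  ultimately show ?thesis using P competitors_Linf[OF X] by (intro ZF_integrable)
qed

lemma competitor_Y_integrable: "X \<in> competitors \<Longrightarrow> integrable M (\<lambda>\<omega>. X \<omega> * Y \<omega>)"
  using Linf_mult_integrable[OF competitors_Linf Y] .

section \<open>Convex structure and weak semicontinuity of the gap\<close>

lemma gap_concavelike: "concavelike \<P> competitors gap"
  unfolding concavelike_def
proof (intro ballI)
  fix X X' t assume *: "X \<in> competitors" "X' \<in> competitors" "t \<in> {0..1::real}"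
  let ?X = "\<lambda>\<omega>. t * X \<omega> + (1 - t) * X' \<omega>"
  have "t * gap P X + (1 - t) * gap P X' \<le> gap P ?X" if P: "P \<in> \<P>" for P
  proof -
    have "(LINT \<omega>|M. ?X \<omega> * Y \<omega>) = (LINT \<omega>|M. t * (X \<omega> * Y \<omega>) + (1 - t) * (X' \<omega> * Y \<omega>))"
      by (simp add: algebra_simps)
    also have "\<dots> = t * (LINT \<omega>|M. X \<omega> * Y \<omega>) + (1 - t) * (LINT \<omega>|M. X' \<omega> * Y \<omega>)"
      using * competitor_Y_integrable by simp
    finally have 1: "(LINT \<omega>|M. ?X \<omega> * Y \<omega>) = \<dots>" .
    have "(LINT \<omega>|M. Z P \<omega> * F \<omega> (?X \<omega>)) \<le>
        (LINT \<omega>|M. t * (Z P \<omega> * F \<omega> (X \<omega>)) + (1 - t) * (Z P \<omega> * F \<omega> (X' \<omega>)))"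
    proof (rule integral_mono_AE)
      show "AE \<omega> in M. Z P \<omega> * F \<omega> (?X \<omega>) \<le> t * (Z P \<omega> * F \<omega> (X \<omega>)) + (1 - t) * (Z P \<omega> * F \<omega> (X' \<omega>))"
        using F_convex_comb
      proof eventually_elim
        case (elim \<omega>)
        then have "F \<omega> (?X \<omega>) \<le> t * F \<omega> (X \<omega>) + (1 - t) * F \<omega> (X' \<omega>)" using * by blast
        from mult_left_mono[OF this Z_nonneg[of P \<omega>]] show ?case by (simp add: algebra_simps)
      qed
    qed (use * P competitor_integrable competitors_convex in auto)
    also have "\<dots> = t * (LINT \<omega>|M. Z P \<omega> * F \<omega> (X \<omega>)) + (1 - t) * (LINT \<omega>|M. Z P \<omega> * F \<omega> (X' \<omega>))"
      using * P competitor_integrable by simp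
    finally show ?thesis unfolding gap_def 1 by (simp add: algebra_simps)
  qed
  then show "\<exists>z\<in>competitors. \<forall>p\<in>\<P>. t * gap p X + (1 - t) * gap p X' \<le> gap p z"
    using competitors_convex[OF *] by (intro bexI[of _ ?X]) auto
qed

lemma gap_convexlike: "convexlike \<P> competitors gap"
  unfolding convexlike_def
proof (intro ballI)
  fix P Q t assume *: "P \<in> \<P>" "Q \<in> \<P>" "t \<in> {0..1::real}"
  then obtain R where R: "R \<in> \<P>" "AE \<omega> in M. Z R \<omega> = t * Z P \<omega> + (1 - t) * Z Q \<omega>"
    using Z_convex[of P Q t] by auto
  have "gap R X = t * gap P X + (1 - t) * gap Q X" if X: "X \<in> competitors" for X
  proof -
    note i = competitor_integrable[OF _ X]
    note [measurable] = borel_measurable_integrable[OF i]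
    have "(LINT \<omega>|M. Z R \<omega> * F \<omega> (X \<omega>)) =
        (LINT \<omega>|M. t * (Z P \<omega> * F \<omega> (X \<omega>)) + (1 - t) * (Z Q \<omega> * F \<omega> (X \<omega>)))"
      using R * by (intro integral_cong_AE) (auto elim!: eventually_mono simp: distrib_right mult.assoc)
    also have "\<dots> = t * (LINT \<omega>|M. Z P \<omega> * F \<omega> (X \<omega>)) + (1 - t) * (LINT \<omega>|M. Z Q \<omega> * F \<omega> (X \<omega>))"
      using i * by simp
    finally show ?thesis by (simp add: gap_def algebra_simps)
  qed
  with R(1) show "\<exists>r\<in>\<P>. \<forall>x\<in>competitors. gap r x \<le> t * gap P x + (1 - t) * gap Q x" by force
qed

text \<open>Bounded, hence an admissible test function for \<open>weak_L1\<close>.\<close>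

definition truncated :: "('a \<Rightarrow> real) \<Rightarrow> real \<Rightarrow> 'a \<Rightarrow> real" where
  "truncated X j \<omega> = max (- j) (min j (F \<omega> (X \<omega>)))"

lemma truncated_Linf:
  assumes "X \<in> Linf M"
  shows "truncated X j \<in> Linf M"
proof -
  note [measurable] = F_measurable[OF Linf_D[OF assms]]
  have "truncated X j \<in> borel_measurable M" unfolding truncated_def by measurable
  then show ?thesis by (rule Linf_I[where C="\<bar>j\<bar>"]) (auto simp: truncated_def)
qed

text \<open>Once \<open>j \<ge> k\<close>, clipping above changes nothing on \<open>A n\<close>, and
  outside \<open>A n\<close> the competitor is \<open>X0\<close>. So almost everywhere the error is
  at most the excess along \<open>X0\<close> over \<open>j\<close>, whose expectation is small
  uniformly in \<open>P\<close>.\<close>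

lemma truncated_tail:
  assumes X: "X \<in> competitors" and e: "e > 0"
  shows "\<exists>j0. \<forall>j\<ge>j0. \<forall>P\<in>\<P>. (LINT \<omega>|M. Z P \<omega> * F \<omega> (X \<omega>)) \<le> (LINT \<omega>|M. truncated X j \<omega> * Z P \<omega>) + e"
proof -
  obtain n k where nk: "AE \<omega> in M. \<omega> \<in> A n \<longrightarrow> F \<omega> (X \<omega>) \<le> k" "\<forall>\<omega>\<in>space M - A n. X \<omega> = X0 \<omega>"
    using X by (auto simp: competitors_def)
  obtain j0 where j0: "\<And>j P. j0 \<le> j \<Longrightarrow> P \<in> \<P> \<Longrightarrow> (LINT \<omega>|M. Z P \<omega> * max 0 (F \<omega> (X0 \<omega>) - j)) \<le> e"
    using X0_tail[OF e] by blast
  show ?thesis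
  proof (rule exI[of _ "max 0 (max k j0)"], intro allI impI ballI)
    fix j P assume j: "max 0 (max k j0) \<le> j" and P: "P \<in> \<P>"
    let ?T = "\<lambda>\<omega>. Z P \<omega> * max 0 (F \<omega> (X0 \<omega>) - j)"
    note [measurable] = F_measurable[OF Linf_D[OF X0]] borel_measurable_integrable[OF Z_integrable[OF P]]
    have T: "integrable M ?T"
    proof (rule Bochner_Integration.integrable_bound[OF X0_integrable[OF P]])
      show "AE \<omega> in M. norm (?T \<omega>) \<le> norm (Z P \<omega> * max 0 (F \<omega> (X0 \<omega>)))"
        using j Z_nonneg[of P] by (auto simp: abs_mult intro!: mult_left_mono)
    qed measurable
    have W: "integrable M (\<lambda>\<omega>. truncated X j \<omega> * Z P \<omega>)"
      using truncated_Linf[OF competitors_Linf[OF X]] Z_integrable[OF P] by (rule Linf_mult_integrable)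
    have "(LINT \<omega>|M. Z P \<omega> * F \<omega> (X \<omega>)) \<le> (LINT \<omega>|M. truncated X j \<omega> * Z P \<omega> + ?T \<omega>)"
    proof (rule integral_mono_AE)
      show "AE \<omega> in M. Z P \<omega> * F \<omega> (X \<omega>) \<le> truncated X j \<omega> * Z P \<omega> + ?T \<omega>"
        using nk(1) AE_space
      proof eventually_elim
        case (elim \<omega>)
        have "F \<omega> (X \<omega>) \<le> truncated X j \<omega> + max 0 (F \<omega> (X0 \<omega>) - j)"
          using elim nk(2) j by (cases "\<omega> \<in> A n") (auto simp: truncated_def)
        from mult_left_mono[OF this Z_nonneg[of P \<omega>]] show ?case by (simp add: algebra_simps)
      qed
    qed (use T W competitor_integrable[OF P X] in auto)
    also have "\<dots> \<le> (LINT \<omega>|M. truncated X j \<omega> * Z P \<omega>) + e"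
      using T W j0[of j P] j P by simp
    finally show "(LINT \<omega>|M. Z P \<omega> * F \<omega> (X \<omega>)) \<le> (LINT \<omega>|M. truncated X j \<omega> * Z P \<omega>) + e" .
  qed
qed

text \<open>Complements \<open>truncated_tail\<close>, for each \<open>P\<close> separately, since
  the dominating function depends on \<open>P\<close>. This suffices for placing a given density in
  one of the open sets of a cover.\<close>

lemma truncated_LIMSEQ:
  assumes P: "P \<in> \<P>" and X: "X \<in> competitors"
  shows "(\<lambda>j. LINT \<omega>|M. truncated X (real j) \<omega> * Z P \<omega>) \<longlonglongrightarrow> (LINT \<omega>|M. Z P \<omega> * F \<omega> (X \<omega>))"
proof (rule integral_dominated_convergence)
  note [measurable] = borel_measurable_integrable[OF Z_integrable[OF P]]
    F_measurable[OF Linf_D[OF competitors_Linf[OF X]]]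
  show "(\<lambda>\<omega>. Z P \<omega> * F \<omega> (X \<omega>)) \<in> borel_measurable M" by measurable
  show "(\<lambda>\<omega>. truncated X (real j) \<omega> * Z P \<omega>) \<in> borel_measurable M" for j unfolding truncated_def by measurable
  show "integrable M (\<lambda>\<omega>. \<bar>Z P \<omega> * F \<omega> (X \<omega>)\<bar>)" using competitor_integrable[OF P X] by simp
  show "AE \<omega> in M. norm (truncated X (real j) \<omega> * Z P \<omega>) \<le> \<bar>Z P \<omega> * F \<omega> (X \<omega>)\<bar>" for j
  proof (rule AE_I2)
    fix \<omega>
    have "\<bar>truncated X (real j) \<omega>\<bar> \<le> \<bar>F \<omega> (X \<omega>)\<bar>" by (auto simp: truncated_def)
    from mult_right_mono[OF this, of "\<bar>Z P \<omega>\<bar>"]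
    show "norm (truncated X (real j) \<omega> * Z P \<omega>) \<le> \<bar>Z P \<omega> * F \<omega> (X \<omega>)\<bar>" by (simp add: abs_mult mult.commute)
  qed
  show "AE \<omega> in M. (\<lambda>j. truncated X (real j) \<omega> * Z P \<omega>) \<longlonglongrightarrow> Z P \<omega> * F \<omega> (X \<omega>)"
  proof (rule AE_I2)
    fix \<omega>
    obtain N where N: "\<bar>F \<omega> (X \<omega>)\<bar> \<le> real N" using real_arch_simple by blast
    have "\<forall>\<^sub>F j in sequentially. truncated X (real j) \<omega> * Z P \<omega> = Z P \<omega> * F \<omega> (X \<omega>)"
      using eventually_ge_at_top[of N]
    proof eventually_elim
      case (elim j)
      then have "real N \<le> real j" by simp
      with N have "truncated X (real j) \<omega> = F \<omega> (X \<omega>)" unfolding truncated_def by linarith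
      then show ?case by simp
    qed
    then show "(\<lambda>j. truncated X (real j) \<omega> * Z P \<omega>) \<longlonglongrightarrow> Z P \<omega> * F \<omega> (X \<omega>)" by (rule tendsto_eventually)
  qed
qed

lemma gap_finite_subcover:
  assumes c: "\<And>P. P \<in> \<P> \<Longrightarrow> \<exists>X\<in>competitors. c < gap P X"
  shows "\<exists>S. finite S \<and> S \<subseteq> competitors \<and> (\<forall>P\<in>\<P>. \<exists>X\<in>S. c < gap P X)"
proof -
  define I where "I = {(X, j, e). X \<in> competitors \<and>
    (\<forall>P\<in>\<P>. (LINT \<omega>|M. Z P \<omega> * F \<omega> (X \<omega>)) \<le> (LINT \<omega>|M. truncated X j \<omega> * Z P \<omega>) + e)}"
  define U where "U = (\<lambda>(X, j, e). {V \<in> topspace (weak_L1 M).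
    (LINT \<omega>|M. truncated X j \<omega> * V \<omega>) \<in> {..< (LINT \<omega>|M. X \<omega> * Y \<omega>) - c - e}})"
  have "openin (weak_L1 M) (U i)" if i_I: "i \<in> I" for i
  proof -
    obtain X j e where i: "i = (X, j, e)" "X \<in> competitors" using i_I by (auto simp: I_def)
    show ?thesis
      unfolding i(1) U_def prod.case
      by (rule openin_continuous_map_preimage[OF continuous_map_weak_L1]) (simp_all add: truncated_Linf competitors_Linf i(2))
  qed
  moreover have "Z ` \<P> \<subseteq> (\<Union>i\<in>I. U i)"
  proof
    fix V assume "V \<in> Z ` \<P>"
    then obtain P where P: "P \<in> \<P>" "V = Z P" by blast
    then obtain X where X: "X \<in> competitors" "c < gap P X" using c by blast
    \<comment> \<open>Half of the excess pays for the uniform truncation error in \<open>I\<close>,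
      the other half for the convergence at this \<open>P\<close>.\<close>
    define e where "e = (gap P X - c) / 2"
    have e: "e > 0" using X by (simp add: e_def)
    obtain j0 where j0: "\<forall>j\<ge>j0. \<forall>P\<in>\<P>. (LINT \<omega>|M. Z P \<omega> * F \<omega> (X \<omega>)) \<le> (LINT \<omega>|M. truncated X j \<omega> * Z P \<omega>) + e"
      using truncated_tail[OF X(1) e] by blast
    have "\<forall>\<^sub>F j in sequentially. (LINT \<omega>|M. truncated X (real j) \<omega> * Z P \<omega>) < (LINT \<omega>|M. Z P \<omega> * F \<omega> (X \<omega>)) + e"
      using order_tendstoD(2)[OF truncated_LIMSEQ[OF P(1) X(1)]] e by simp
    moreover have "\<forall>\<^sub>F j in sequentially. j0 \<le> real j"
      using filterlim_real_sequentially by (auto simp: filterlim_at_top)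
    ultimately have "\<forall>\<^sub>F j in sequentially. (LINT \<omega>|M. truncated X (real j) \<omega> * Z P \<omega>) < (LINT \<omega>|M. Z P \<omega> * F \<omega> (X \<omega>)) + e \<and> j0 \<le> real j"
      by (rule eventually_conj)
    then obtain j :: nat where j: "(LINT \<omega>|M. truncated X (real j) \<omega> * Z P \<omega>) < (LINT \<omega>|M. Z P \<omega> * F \<omega> (X \<omega>)) + e" "j0 \<le> real j"
      using eventually_happens'[OF sequentially_bot] by blast
    have "(X, real j, e) \<in> I" using X j0 j by (simp add: I_def)
    moreover have "V \<in> U (X, real j, e)"
      using j P compactin_subset_topspace[OF Z_compact] by (auto simp: U_def e_def gap_def field_simps)
    ultimately show "V \<in> (\<Union>i\<in>I. U i)" by blast
  qed
  ultimately obtain \<F> where F: "finite \<F>" "\<F> \<subseteq> U ` I" "Z ` \<P> \<subseteq> \<Union>\<F>"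
    using Z_compact unfolding compactin_def by (metis (no_types, lifting) imageE)
  then obtain J where J: "finite J" "J \<subseteq> I" "Z ` \<P> \<subseteq> (\<Union>i\<in>J. U i)"
    using finite_subset_image[OF F(1,2)] by metis
  show ?thesis
  proof (intro exI[of _ "fst ` J"] conjI ballI)
    show "finite (fst ` J)" using J by simp
    show "fst ` J \<subseteq> competitors" using J by (auto simp: I_def)
    fix P assume P: "P \<in> \<P>"
    then obtain X j e where i: "(X, j, e) \<in> J" "Z P \<in> U (X, j, e)" using J(3) by fast
    then have "(LINT \<omega>|M. Z P \<omega> * F \<omega> (X \<omega>)) \<le> (LINT \<omega>|M. truncated X j \<omega> * Z P \<omega>) + e"
      using J(2) P by (auto simp: I_def)
    with i(2) have "c < gap P X" by (auto simp: U_def gap_def)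
    then show "\<exists>X\<in>fst ` J. c < gap P X" using i(1) by force
  qed
qed

lemma gap_minimax:
  assumes "\<And>P. P \<in> \<P> \<Longrightarrow> \<exists>X\<in>competitors. c < gap P X" "d < c"
  shows "\<exists>X\<in>competitors. \<forall>P\<in>\<P>. d \<le> gap P X"
  using gap_finite_subcover[OF assms(1)] Kneser_Fan_minimax[OF _ _ _ gap_convexlike gap_concavelike _ assms(2)]
    X0_competitor by (metis empty_iff)

section \<open>Reaching the Fenchel envelope for one fixed measure\<close>

definition integrand :: "'p \<Rightarrow> 'a \<Rightarrow> real \<Rightarrow> real" where
  "integrand P \<omega> x = x * Y \<omega> - Z P \<omega> * F \<omega> x"

text \<open>The second component of the decoded pair is ignored; it is a counter that makes every
  rational occur at arbitrarily late indices.\<close>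

definition rational_seq :: "nat \<Rightarrow> real" where
  "rational_seq m = of_rat (from_nat (fst (prod_decode m)))"

lemma rational_seq_frequently:
  assumes "x \<in> \<rat>"
  shows "\<exists>m\<ge>N. rational_seq m = x"
proof -
  obtain r where "x = of_rat r" using assms by (auto elim: Rats_cases)
  then show ?thesis
    by (intro exI[of _ "prod_encode (to_nat r, N)"]) (simp add: rational_seq_def le_prod_encode_2)
qed

text \<open>A rational is tried only at stages that bound \<open>F\<close> at it, so that every stage is a competitor;
  this is why each rational has to recur in the enumeration.\<close>

primrec greedy :: "'p \<Rightarrow> nat \<Rightarrow> 'a \<Rightarrow> real" where
  "greedy P 0 = X0"
| "greedy P (Suc m) = (\<lambda>\<omega>. if \<omega> \<in> A m \<and> F \<omega> (rational_seq m) \<le> real m \<and>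
      integrand P \<omega> (greedy P m \<omega>) < integrand P \<omega> (rational_seq m)
    then rational_seq m else greedy P m \<omega>)"

lemma greedy_competitor:
  assumes P: "P \<in> \<P>"
  shows "greedy P m \<in> competitors"
proof (induction m)
  case 0
  show ?case using X0_competitor by simp
next
  case (Suc m)
  obtain N K where NK: "\<And>n k. N \<le> n \<Longrightarrow> K \<le> k \<Longrightarrow> real n \<le> k \<Longrightarrow>
    (AE \<omega> in M. \<omega> \<in> A n \<longrightarrow> F \<omega> (greedy P m \<omega>) \<le> k) \<and> (\<forall>\<omega>\<in>space M - A n. greedy P m \<omega> = X0 \<omega>)"
    using competitorE[OF Suc] by blast
  \<comment> \<open>Stage \<open>m\<close> changes the function only on \<open>A m\<close>, and only
    to a value at which \<open>F\<close> is at most \<open>m\<close>.\<close>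
  define n where "n = max N m"
  define k where "k = max K (real n)"
  have *: "AE \<omega> in M. \<omega> \<in> A n \<longrightarrow> F \<omega> (greedy P m \<omega>) \<le> k" "\<forall>\<omega>\<in>space M - A n. greedy P m \<omega> = X0 \<omega>"
    using NK[of n k] by (auto simp: n_def k_def)
  have mk: "real m \<le> k" by (simp add: k_def n_def)
  have "AE \<omega> in M. \<omega> \<in> A n \<longrightarrow> F \<omega> (greedy P (Suc m) \<omega>) \<le> k"
    using *(1) by eventually_elim (use mk in auto)
  moreover have "\<forall>\<omega>\<in>space M - A n. greedy P (Suc m) \<omega> = X0 \<omega>"
    using *(2) incseqD[OF A_incseq, of m n] by (auto simp: n_def)
  moreover have "greedy P (Suc m) \<in> Linf M"
  proof -
    note Suc_Linf = competitors_Linf[OF Suc]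
    obtain C where C: "AE \<omega> in M. \<bar>greedy P m \<omega>\<bar> \<le> C" using Suc_Linf by (auto simp: Linf_def)
    note [measurable] = Linf_D[OF Suc_Linf] F_measurable[OF Linf_D[OF Suc_Linf]] A_sets
      F_measurable[of "\<lambda>_. rational_seq m", simplified] borel_measurable_integrable[OF Y]
      borel_measurable_integrable[OF Z_integrable[OF P]]
    show ?thesis
    proof (rule Linf_I[where C="max C \<bar>rational_seq m\<bar>"])
      show "greedy P (Suc m) \<in> borel_measurable M" unfolding greedy.simps integrand_def by measurable
      show "AE \<omega> in M. \<bar>greedy P (Suc m) \<omega>\<bar> \<le> max C \<bar>rational_seq m\<bar>"
        using C by eventually_elim auto
    qed
  qed
  ultimately show ?case unfolding competitors_def by blast
qed

lemma integrand_greedy_incseq: "incseq (\<lambda>m. integrand P \<omega> (greedy P m \<omega>))"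
  by (rule incseq_SucI) auto

text \<open>Each greedy stage is a competitor, so its integral is at most \<open>c\<close>; the
  stages increase, and monotone convergence bounds the integral of their supremum. Almost every
  \<open>\<omega>\<close> lies in all late \<open>A m\<close>, so every rational is eventually tried
  there, and continuity of the finite convex function extends the bound to all reals.\<close>

lemma ext_expectation_envelope_le:
  assumes P: "P \<in> \<P>" and c: "\<And>X. X \<in> competitors \<Longrightarrow> gap P X \<le> c"
  shows "ext_expectation M (\<lambda>\<omega>. SUP x. ereal (integrand P \<omega> x)) \<le> ereal c"
proof -
  define h where "h m \<omega> = integrand P \<omega> (greedy P m \<omega>)" for m \<omega>
  \<comment> \<open>The gain over stage 0 is nonnegative, as monotone convergence requires; where it
    is infinite, the bound on the envelope is trivial.\<close>
  define g where "g \<omega> = (SUP m. ennreal (h m \<omega> - h 0 \<omega>))" for \<omega>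
  have mono: "h m \<omega> \<le> h n \<omega>" if "m \<le> n" for m n \<omega>
    using incseqD[OF integrand_greedy_incseq that] by (simp add: h_def)
  have int: "integrable M (h m)" and h_gap: "(LINT \<omega>|M. h m \<omega>) = gap P (greedy P m)" for m
    using competitor_integrable[OF P greedy_competitor[OF P, of m]] competitor_Y_integrable[OF greedy_competitor[OF P, of m]]
    by (simp_all add: h_def[abs_def] integrand_def gap_def)
  note [measurable] = borel_measurable_integrable[OF int]
  have g: "g \<in> borel_measurable M" unfolding g_def by measurable
  have "(\<integral>\<^sup>+\<omega>. g \<omega> \<partial>M) = (SUP m. \<integral>\<^sup>+\<omega>. ennreal (h m \<omega> - h 0 \<omega>) \<partial>M)"
    unfolding g_def by (rule nn_integral_monotone_convergence_SUP) (auto simp: incseq_def le_fun_def intro!: ennreal_leI mono)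
  also have "\<dots> \<le> ennreal (c - gap P X0)"
  proof (rule SUP_least)
    fix m
    have "(\<integral>\<^sup>+\<omega>. ennreal (h m \<omega> - h 0 \<omega>) \<partial>M) = ennreal (LINT \<omega>|M. h m \<omega> - h 0 \<omega>)"
      using int mono by (intro nn_integral_eq_integral) auto
    also have "(LINT \<omega>|M. h m \<omega> - h 0 \<omega>) = gap P (greedy P m) - gap P X0"
      using int h_gap[of m] h_gap[of 0] by simp
    finally show "(\<integral>\<^sup>+\<omega>. ennreal (h m \<omega> - h 0 \<omega>) \<partial>M) \<le> ennreal (c - gap P X0)"
      using c[OF greedy_competitor[OF P, of m]] by (simp add: ennreal_leI)
  qed
  finally have g_le: "(\<integral>\<^sup>+\<omega>. g \<omega> \<partial>M) \<le> ennreal (c - gap P X0)" .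
  have "AE \<omega> in M. (SUP x. ereal (integrand P \<omega> x)) \<le> ereal (h 0 \<omega>) + enn2ereal (g \<omega>)"
    using A_cover F_convex
  proof eventually_elim
    case (elim \<omega>)
    from elim(1) obtain n where n: "\<omega> \<in> A n" by blast
    have cont: "continuous_on UNIV (integrand P \<omega>)"
      unfolding integrand_def
      using convex_on_continuous[OF open_UNIV elim(2)] by (intro continuous_intros)
    have rat: "\<exists>m. integrand P \<omega> x \<le> h m \<omega>" if x: "x \<in> \<rat>" for x
    proof -
      obtain k :: nat where k: "F \<omega> x \<le> real k" using real_arch_simple by blast
      obtain m where m: "max n k \<le> m" "rational_seq m = x" using rational_seq_frequently[OF x] by blast
      have "\<omega> \<in> A m" using incseqD[OF A_incseq, of n m] m n by auto
      moreover have "F \<omega> x \<le> real m" using k m(1) by linarith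
      ultimately have "integrand P \<omega> x \<le> h (Suc m) \<omega>" using m(2) by (auto simp: h_def)
      then show ?thesis by blast
    qed
    show ?case
    proof (cases "g \<omega> = \<infinity>")
      case True
      then show ?thesis by simp
    next
      case False
      then obtain b where b: "g \<omega> = ennreal b" "0 \<le> b" by (cases "g \<omega>") auto
      have hb: "h m \<omega> \<le> h 0 \<omega> + b" for m
      proof -
        have "ennreal (h m \<omega> - h 0 \<omega>) \<le> ennreal b" unfolding b(1)[symmetric] g_def by (rule SUP_upper) simp
        then show ?thesis using b(2) by (simp add: ennreal_le_iff)
      qed
      have "integrand P \<omega> x \<le> h 0 \<omega> + b" for x
      proof (rule continuous_le_on_closure[where S="\<rat>" and f="integrand P \<omega>" and x=x])
        show "continuous_on (closure \<rat>) (integrand P \<omega>)" using cont by (rule continuous_on_subset) simp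
        show "x \<in> closure \<rat>" by (simp add: Rats_closure_real)
        show "integrand P \<omega> y \<le> h 0 \<omega> + b" if "y \<in> \<rat>" for y using rat[OF that] hb by (meson order_trans)
      qed
      then show ?thesis using b by (auto intro!: SUP_least)
    qed
  qed
  then have "ext_expectation M (\<lambda>\<omega>. SUP x. ereal (integrand P \<omega> x)) \<le> ereal ((LINT \<omega>|M. h 0 \<omega>) + (c - gap P X0))"
    using int g g_le c[OF X0_competitor] by (intro ext_expectation_le_add) auto
  then show ?thesis using h_gap[of 0] by simp
qed

end

section \<open>Densities and uniform integrability\<close>

context prob_space
begin

lemma
  assumes "P \<in> ac_prob_measures M"
  shows dens_integrable: "integrable M (dens M P)" and density_dens: "P = density M (\<lambda>\<omega>. ennreal (dens M P \<omega>))"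
proof -
  from assms have P: "prob_space P" "sets P = sets M" "absolutely_continuous M P"
    by (auto simp: ac_prob_measures_def)
  interpret P: prob_space P by (rule P)
  have fin: "AE \<omega> in M. RN_deriv M P \<omega> = ennreal (dens M P \<omega>)"
    using RN_deriv_finite[OF P.sigma_finite_measure_axioms P(3,2)]
    by eventually_elim (simp add: dens_def less_top)
  have [measurable]: "dens M P \<in> borel_measurable M"
    unfolding dens_def[abs_def] by measurable
  show eq: "P = density M (\<lambda>\<omega>. ennreal (dens M P \<omega>))"
    using density_RN_deriv[OF P(3,2)] density_cong[OF _ _ fin] by simp
  show "integrable M (dens M P)"
  proof (rule integrableI_nonneg)
    have "(\<integral>\<^sup>+\<omega>. ennreal (dens M P \<omega>) \<partial>M) = emeasure P (space M)"
      by (subst eq) (auto simp: emeasure_density intro!: nn_integral_cong)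
    also have "\<dots> = 1" using P.emeasure_space_1 sets_eq_imp_space_eq[OF P(2)] by simp
    finally show "(\<integral>\<^sup>+\<omega>. ennreal (dens M P \<omega>) \<partial>M) < \<infinity>" by simp
  qed (auto simp: dens_def)
qed

lemma dens_convex:
  assumes "P \<in> ac_prob_measures M" "Q \<in> ac_prob_measures M" "R \<in> ac_prob_measures M" and t: "0 \<le> t" "t \<le> 1"
    and R: "\<And>A. A \<in> sets M \<Longrightarrow> measure R A = t * measure P A + (1 - t) * measure Q A"
  shows "AE \<omega> in M. dens M R \<omega> = t * dens M P \<omega> + (1 - t) * dens M Q \<omega>"
proof -
  let ?D = "\<lambda>\<omega>. t * dens M P \<omega> + (1 - t) * dens M Q \<omega>"
  from assms(1-3) have ps: "prob_space P" "prob_space Q" "prob_space R" and sR: "sets R = sets M"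
    by (auto simp: ac_prob_measures_def)
  interpret P: prob_space P by (rule ps)
  interpret Q: prob_space Q by (rule ps)
  interpret R: prob_space R by (rule ps)
  note [measurable] = borel_measurable_integrable[OF dens_integrable[OF assms(1)]]
    borel_measurable_integrable[OF dens_integrable[OF assms(2)]]
  have nn: "0 \<le> dens M S \<omega>" for S \<omega> by (simp add: dens_def)
  have "density M (\<lambda>\<omega>. ennreal (?D \<omega>)) = R"
  proof (rule measure_eqI)
    fix A assume "A \<in> sets (density M (\<lambda>\<omega>. ennreal (?D \<omega>)))"
    then have A[measurable]: "A \<in> sets M" by simp
    have e: "emeasure P A = (\<integral>\<^sup>+\<omega>. ennreal (dens M P \<omega>) * indicator A \<omega> \<partial>M)"
      "emeasure Q A = (\<integral>\<^sup>+\<omega>. ennreal (dens M Q \<omega>) * indicator A \<omega> \<partial>M)"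
      by (subst density_dens[OF assms(1)], simp add: emeasure_density)
         (subst density_dens[OF assms(2)], simp add: emeasure_density)
    have "emeasure (density M (\<lambda>\<omega>. ennreal (?D \<omega>))) A = (\<integral>\<^sup>+\<omega>. ennreal (?D \<omega>) * indicator A \<omega> \<partial>M)"
      by (simp add: emeasure_density)
    also have "\<dots> = (\<integral>\<^sup>+\<omega>. ennreal t * (ennreal (dens M P \<omega>) * indicator A \<omega>) +
        ennreal (1 - t) * (ennreal (dens M Q \<omega>) * indicator A \<omega>) \<partial>M)"
      using t nn by (intro nn_integral_cong) (auto simp: ennreal_plus ennreal_mult distrib_right mult.assoc)
    also have "\<dots> = ennreal t * emeasure P A + ennreal (1 - t) * emeasure Q A"
      unfolding e by (simp add: nn_integral_add nn_integral_cmult)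
    also have "\<dots> = emeasure R A"
      using t by (simp add: P.emeasure_eq_measure Q.emeasure_eq_measure R.emeasure_eq_measure R[OF A]
          ennreal_plus ennreal_mult)
    finally show "emeasure (density M (\<lambda>\<omega>. ennreal (?D \<omega>))) A = emeasure R A" .
  qed (simp add: sR)
  then have "AE \<omega> in M. ennreal (?D \<omega>) = RN_deriv M R \<omega>" by (intro RN_deriv_unique) auto
  then show ?thesis
  proof eventually_elim
    case (elim \<omega>)
    show ?case unfolding dens_def[of M R] elim[symmetric] using t nn by (intro enn2real_ennreal) auto
  qed
qed

lemma ext_expectation_dens:
  assumes P: "P \<in> ac_prob_measures M" and g: "g \<in> borel_measurable M"
    and f: "AE \<omega> in M. f \<omega> = ereal (g \<omega>)"
  shows "ext_expectation P f = ext_expectation M (\<lambda>\<omega>. ereal (dens M P \<omega> * g \<omega>))"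
proof -
  have ac: "sets P = sets M" "absolutely_continuous M P" using P by (auto simp: ac_prob_measures_def)
  have nn: "0 \<le> dens M P \<omega>" for \<omega> by (simp add: dens_def)
  note [measurable] = g borel_measurable_integrable[OF dens_integrable[OF P]]
  have i: "(\<integral>\<^sup>+\<omega>. e2ennreal (max 0 (ereal (w \<omega>))) \<partial>P) = (\<integral>\<^sup>+\<omega>. e2ennreal (max 0 (ereal (dens M P \<omega> * w \<omega>))) \<partial>M)"
    if [measurable]: "w \<in> borel_measurable M" for w :: "'a \<Rightarrow> real"
  proof -
    have e: "e2ennreal (max 0 (ereal x)) = ennreal x" for x
      by (cases "0 \<le> x") (auto simp: max_def e2ennreal_ereal e2ennreal_neg ennreal_neg)
    show ?thesis
      unfolding e using nn
      by (subst density_dens[OF P]) (simp add: nn_integral_density ennreal_mult')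
  qed
  have "ext_expectation P f = ext_expectation P (\<lambda>\<omega>. ereal (g \<omega>))"
    by (rule ext_expectation_cong_AE, rule absolutely_continuous_AE[OF ac]) (use f in auto)
  also have "\<dots> = ext_expectation M (\<lambda>\<omega>. ereal (dens M P \<omega> * g \<omega>))"
    unfolding ext_expectation_def using i[of g] i[of "\<lambda>\<omega>. - g \<omega>"] by simp
  finally show ?thesis .
qed

text \<open>Uniform integrability cuts where the product with the density is large, a set that
  depends on \<open>P\<close>. The last claim cuts where \<open>F\<close> along \<open>X\<close>
  exceeds \<open>j\<close>, a set that is the same for all \<open>P\<close> and whose probability
  tends to 0. On it the product is either at least \<open>c\<close>, which uniform integrability
  covers, or below \<open>c\<close>, which contributes at most \<open>c\<close> times the
  probability.\<close>

lemma UI_dom_uniform_bounds: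
  assumes X: "X \<in> UI_dom M f \<P>" and \<P>: "\<P> \<subseteq> ac_prob_measures M"
    and F: "(\<lambda>\<omega>. F \<omega> (X \<omega>)) \<in> borel_measurable M" and fF: "AE \<omega> in M. f \<omega> (X \<omega>) = ereal (F \<omega> (X \<omega>))"
  shows "\<And>P. P \<in> \<P> \<Longrightarrow> integrable M (\<lambda>\<omega>. dens M P \<omega> * max 0 (F \<omega> (X \<omega>)))"
    and "\<exists>C. \<forall>P\<in>\<P>. (LINT \<omega>|M. dens M P \<omega> * max 0 (F \<omega> (X \<omega>))) \<le> C"
    and "\<And>e::real. e > 0 \<Longrightarrow> \<exists>j0. \<forall>j\<ge>j0. \<forall>P\<in>\<P>. (LINT \<omega>|M. dens M P \<omega> * max 0 (F \<omega> (X \<omega>) - j)) \<le> e"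
proof -
  define u where "u P \<omega> = dens M P \<omega> * max 0 (F \<omega> (X \<omega>))" for P \<omega>
  define I where "I c P = (\<integral>\<^sup>+\<omega>. ennreal (u P \<omega>) * indicator {\<omega>. c \<le> u P \<omega>} \<omega> \<partial>M)" for c :: real and P
  have nn: "0 \<le> dens M P \<omega>" for P \<omega> by (simp add: dens_def)
  have u0: "0 \<le> u P \<omega>" for P \<omega> using nn by (simp add: u_def)
  have dm: "dens M P \<in> borel_measurable M" for P unfolding dens_def[abs_def] by measurable
  note [measurable] = F dm
  have um[measurable]: "u P \<in> borel_measurable M" for P unfolding u_def by measurable
  have tail: "\<exists>c>0. \<forall>P\<in>\<P>. I c P \<le> ennreal e" if e: "e > 0" for e
  proof -
    let ?h = "\<lambda>P \<omega>. max 0 (f \<omega> (X \<omega>)) * ereal (dens M P \<omega>)"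
    have "((\<lambda>c::real. SUP h\<in>?h ` \<P>. \<integral>\<^sup>+\<omega>. e2ennreal \<bar>h \<omega>\<bar> * indicator {\<omega>. ereal c \<le> \<bar>h \<omega>\<bar>} \<omega> \<partial>M) \<longlongrightarrow> 0) at_top"
      using X by (simp add: UI_dom_def uniformly_integrable_def)
    then have "\<forall>\<^sub>F c::real in at_top. (SUP h\<in>?h ` \<P>. \<integral>\<^sup>+\<omega>. e2ennreal \<bar>h \<omega>\<bar> * indicator {\<omega>. ereal c \<le> \<bar>h \<omega>\<bar>} \<omega> \<partial>M) < ennreal e"
      using e by (intro order_tendstoD) auto
    then have "\<forall>\<^sub>F c::real in at_top. 0 < c \<and> (SUP h\<in>?h ` \<P>. \<integral>\<^sup>+\<omega>. e2ennreal \<bar>h \<omega>\<bar> * indicator {\<omega>. ereal c \<le> \<bar>h \<omega>\<bar>} \<omega> \<partial>M) < ennreal e"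
      using eventually_gt_at_top[of 0] by eventually_elim auto
    then obtain c :: real where c: "0 < c"
      "(SUP h\<in>?h ` \<P>. \<integral>\<^sup>+\<omega>. e2ennreal \<bar>h \<omega>\<bar> * indicator {\<omega>. ereal c \<le> \<bar>h \<omega>\<bar>} \<omega> \<partial>M) < ennreal e"
      using eventually_happens'[OF trivial_limit_at_top_linorder] by blast
    have "I c P \<le> ennreal e" if P: "P \<in> \<P>" for P
    proof -
      have "I c P = (\<integral>\<^sup>+\<omega>. e2ennreal \<bar>?h P \<omega>\<bar> * indicator {\<omega>. ereal c \<le> \<bar>?h P \<omega>\<bar>} \<omega> \<partial>M)"
        unfolding I_def
      proof (rule nn_integral_cong_AE)
        show "AE \<omega> in M. ennreal (u P \<omega>) * indicator {\<omega>. c \<le> u P \<omega>} \<omega> =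
            e2ennreal \<bar>?h P \<omega>\<bar> * indicator {\<omega>. ereal c \<le> \<bar>?h P \<omega>\<bar>} \<omega>"
          using fF
        proof eventually_elim
          case (elim \<omega>)
          have "max 0 (f \<omega> (X \<omega>)) = ereal (max 0 (F \<omega> (X \<omega>)))" unfolding elim by (auto simp: max_def)
          then have "?h P \<omega> = ereal (u P \<omega>)" by (simp only: times_ereal.simps u_def mult.commute)
          then have "\<bar>?h P \<omega>\<bar> = ereal (u P \<omega>)" using u0[of P \<omega>] by simp
          then show ?case by (simp add: e2ennreal_ereal indicator_def)
        qed
      qed
      also have "\<dots> \<le> (SUP h\<in>?h ` \<P>. \<integral>\<^sup>+\<omega>. e2ennreal \<bar>h \<omega>\<bar> * indicator {\<omega>. ereal c \<le> \<bar>h \<omega>\<bar>} \<omega> \<partial>M)"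
        using P by (intro SUP_upper imageI)
      finally show ?thesis using c(2) by simp
    qed
    with c show ?thesis by blast
  qed
  \<comment> \<open>Tail mass 1 suffices for a bound in \<open>L1\<close>: below \<open>c1\<close>
    the product contributes at most \<open>c1\<close>, as \<open>M\<close> is a probability.\<close>
  obtain c1 where c1: "c1 > 0" "\<And>P. P \<in> \<P> \<Longrightarrow> I c1 P \<le> ennreal 1" using tail[of 1] by auto
  have bound: "(\<integral>\<^sup>+\<omega>. ennreal (u P \<omega>) \<partial>M) \<le> ennreal (c1 + 1)" if P: "P \<in> \<P>" for P
  proof -
    have "(\<integral>\<^sup>+\<omega>. ennreal (u P \<omega>) \<partial>M) \<le> (\<integral>\<^sup>+\<omega>. ennreal c1 + ennreal (u P \<omega>) * indicator {\<omega>. c1 \<le> u P \<omega>} \<omega> \<partial>M)"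
      by (rule nn_integral_mono) (auto simp: indicator_def ennreal_leI)
    also have "\<dots> = ennreal c1 + I c1 P"
      unfolding I_def by (subst nn_integral_add) (auto simp: emeasure_space_1)
    also have "\<dots> \<le> ennreal c1 + ennreal 1" using c1(2)[OF P] by (intro add_left_mono)
    finally show ?thesis using c1(1) by (simp add: ennreal_plus)
  qed
  have int: "integrable M (u P)" if P: "P \<in> \<P>" for P
    using u0 order_le_less_trans[OF bound[OF P], of \<infinity>] by (intro integrableI_nonneg) auto
  then show "integrable M (\<lambda>\<omega>. dens M P \<omega> * max 0 (F \<omega> (X \<omega>)))" if "P \<in> \<P>" for P
    using that by (simp add: u_def[abs_def])
  have "(LINT \<omega>|M. u P \<omega>) \<le> c1 + 1" if P: "P \<in> \<P>" for P
    using bound[OF P] int[OF P] u0 c1(1) by (simp add: nn_integral_eq_integral del: ennreal_plus)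
  then show "\<exists>C. \<forall>P\<in>\<P>. (LINT \<omega>|M. dens M P \<omega> * max 0 (F \<omega> (X \<omega>))) \<le> C"
    by (auto simp: u_def)
  show "\<exists>j0. \<forall>j\<ge>j0. \<forall>P\<in>\<P>. (LINT \<omega>|M. dens M P \<omega> * max 0 (F \<omega> (X \<omega>) - j)) \<le> e" if e: "e > 0" for e :: real
  proof -
    obtain c where c: "c > 0" "\<And>P. P \<in> \<P> \<Longrightarrow> I c P \<le> ennreal (e / 2)" using tail[of "e / 2"] e by auto
    define B where "B j = {\<omega> \<in> space M. j < F \<omega> (X \<omega>)}" for j :: real
    have B[measurable]: "B j \<in> sets M" for j unfolding B_def by measurable
    have "(\<lambda>n. prob (B (real n))) \<longlonglongrightarrow> prob (\<Inter>n. B (real n))"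
      by (rule finite_Lim_measure_decseq) (auto simp: B_def decseq_def)
    moreover have "(\<Inter>n. B (real n)) = {}"
      using real_arch_simple by (fastforce simp: B_def not_less[symmetric])
    ultimately have "(\<lambda>n. prob (B (real n))) \<longlonglongrightarrow> 0" by simp
    then have "\<forall>\<^sub>F n in sequentially. prob (B (real n)) < e / (2 * c)"
      using c e by (intro order_tendstoD) auto
    then obtain N where N: "prob (B (real N)) < e / (2 * c)"
      using eventually_happens'[OF sequentially_bot] by blast
    show ?thesis
    proof (intro exI[of _ "real N"] allI impI ballI)
      fix j P assume j: "real N \<le> j" and P: "P \<in> \<P>"
      let ?T = "\<lambda>\<omega>. dens M P \<omega> * max 0 (F \<omega> (X \<omega>) - j)"
      have j0: "0 \<le> j" using j by linarith
      have T0: "0 \<le> ?T \<omega>" for \<omega> using nn by simp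
      have Tu: "?T \<omega> \<le> u P \<omega>" for \<omega> unfolding u_def using j0 nn by (intro mult_left_mono) auto
      have T: "integrable M ?T"
        by (rule Bochner_Integration.integrable_bound[OF int[OF P]]) (use T0 Tu u0 in auto)
      have "(\<integral>\<^sup>+\<omega>. ennreal (?T \<omega>) \<partial>M) \<le>
          (\<integral>\<^sup>+\<omega>. ennreal (u P \<omega>) * indicator {\<omega>. c \<le> u P \<omega>} \<omega> + ennreal c * indicator (B j) \<omega> \<partial>M)"
      proof (rule nn_integral_mono)
        fix \<omega> assume w: "\<omega> \<in> space M"
        show "ennreal (?T \<omega>) \<le> ennreal (u P \<omega>) * indicator {\<omega>. c \<le> u P \<omega>} \<omega> + ennreal c * indicator (B j) \<omega>"
        proof (cases "\<omega> \<in> B j")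
          case False
          then have T_zero: "?T \<omega> = 0" using w by (auto simp: B_def)
          show ?thesis unfolding T_zero by simp
        next
          case True
          show ?thesis
          proof (cases "c \<le> u P \<omega>")
            case True
            then show ?thesis using Tu[of \<omega>] by (auto intro!: add_increasing2 ennreal_leI)
          next
            case False
            then show ?thesis using Tu[of \<omega>] \<open>\<omega> \<in> B j\<close> by (auto intro!: ennreal_leI)
          qed
        qed
      qed
      also have "\<dots> = I c P + ennreal c * emeasure M (B j)"
        unfolding I_def by (subst nn_integral_add) (auto simp: nn_integral_cmult_indicator)
      also have "\<dots> \<le> ennreal (e / 2) + ennreal (e / 2)"
      proof (rule add_mono[OF c(2)[OF P]])
        have "prob (B j) \<le> prob (B (real N))" using j by (intro finite_measure_mono) (auto simp: B_def)
        then have "c * prob (B j) \<le> c * prob (B (real N))" using c(1) by (intro mult_left_mono) auto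
        also have "\<dots> \<le> e / 2" using N c(1) by (simp add: field_simps)
        finally have "c * prob (B j) \<le> e / 2" .
        then show "ennreal c * emeasure M (B j) \<le> ennreal (e / 2)"
          using c(1) by (simp add: emeasure_eq_measure ennreal_leI flip: ennreal_mult)
      qed
      also have "\<dots> = ennreal e" using e by (simp flip: ennreal_plus)
      finally show "(LINT \<omega>|M. ?T \<omega>) \<le> e" using T T0 e by (simp add: nn_integral_eq_integral)
    qed
  qed
qed

end

section \<open>Normal convex integrands\<close>

lemma normal_convex_integrand_real:
  assumes f: "normal_convex_integrand M f" and fin: "AE \<omega> in M. \<forall>x. f \<omega> x < \<infinity>"
  defines "F \<equiv> \<lambda>\<omega> x. real_of_ereal (f \<omega> x)"
  shows "AE \<omega> in M. \<forall>x. f \<omega> x = ereal (F \<omega> x)"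
    and "AE \<omega> in M. convex_on UNIV (F \<omega>)"
    and "\<And>X. X \<in> borel_measurable M \<Longrightarrow> (\<lambda>\<omega>. F \<omega> (X \<omega>)) \<in> borel_measurable M"
proof -
  show eq: "AE \<omega> in M. \<forall>x. f \<omega> x = ereal (F \<omega> x)"
    using fin AE_space
  proof eventually_elim
    case (elim \<omega>)
    then have "\<bar>f \<omega> x\<bar> \<noteq> \<infinity>" for x
      using f unfolding normal_convex_integrand_def by (metis ereal_infinity_cases less_irrefl)
    then show ?case by (simp add: F_def ereal_real')
  qed
  have "AE \<omega> in M. ext_convex (f \<omega>)" using f by (auto simp: normal_convex_integrand_def)
  then show "AE \<omega> in M. convex_on UNIV (F \<omega>)"
    using eq
  proof eventually_elim
    case (elim \<omega>)
    show ?case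
    proof (rule convex_onI)
      fix t x y :: real assume t: "0 < t" "t < 1"
      then have "f \<omega> (t * y + (1 - t) * x) \<le> ereal t * f \<omega> y + ereal (1 - t) * f \<omega> x"
        using elim(1) by (auto simp: ext_convex_def)
      then show "F \<omega> ((1 - t) *\<^sub>R x + t *\<^sub>R y) \<le> (1 - t) * F \<omega> x + t * F \<omega> y"
        using elim(2) by (simp add: add.commute)
    qed simp
  qed
  fix X :: "'a \<Rightarrow> real" assume [measurable]: "X \<in> borel_measurable M"
  have [measurable]: "(\<lambda>(\<omega>, x). f \<omega> x) \<in> borel_measurable (M \<Otimes>\<^sub>M borel)"
    using f by (simp add: normal_convex_integrand_def)
  have "(\<lambda>\<omega>. (\<lambda>(\<omega>, x). f \<omega> x) (\<omega>, X \<omega>)) \<in> borel_measurable M" by measurable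
  then show "(\<lambda>\<omega>. F \<omega> (X \<omega>)) \<in> borel_measurable M" by (simp add: F_def)
qed

lemma (in prob_space) robust_integrand_dens:
  assumes \<P>: "\<P> \<subseteq> ac_prob_measures M" and "convex_measures M \<P>" and comp: "compactin (weak_L1 M) (dens M ` \<P>)"
    and f: "normal_convex_integrand M f" and fin: "AE \<omega> in M. \<forall>x. f \<omega> x < \<infinity>"
    and Y: "\<forall>P\<in>\<P>. \<exists>Y\<in>L1 M. ext_integrable M (\<lambda>\<omega>. max 0 (ftilde f \<omega> (Y \<omega>) (dens M P \<omega>)))"
  shows "robust_integrand M \<P> (dens M) (\<lambda>\<omega> x. real_of_ereal (f \<omega> x))"
proof
  note F = normal_convex_integrand_real[OF f fin]
  show "integrable M (dens M P)" if "P \<in> \<P>" for P using that \<P> by (intro dens_integrable) auto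
  show "0 \<le> dens M P \<omega>" for P \<omega> by (simp add: dens_def)
  show "(\<lambda>\<omega>. real_of_ereal (f \<omega> (X \<omega>))) \<in> borel_measurable M" if "X \<in> borel_measurable M" for X
    using F(3)[OF that] .
  show "AE \<omega> in M. convex_on UNIV (\<lambda>x. real_of_ereal (f \<omega> x))" using F(2) .
  show "compactin (weak_L1 M) (dens M ` \<P>)" by (rule comp)
  show "\<exists>R\<in>\<P>. AE \<omega> in M. dens M R \<omega> = t * dens M P \<omega> + (1 - t) * dens M Q \<omega>"
    if PQ: "P \<in> \<P>" "Q \<in> \<P>" "0 \<le> t" "t \<le> 1" for P Q t
  proof -
    have "t \<in> {0..1}" using PQ by simp
    then obtain R where R: "R \<in> \<P>" "\<forall>A\<in>sets M. measure R A = t * measure P A + (1 - t) * measure Q A"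
      using assms(2)[unfolded convex_measures_def, rule_format, OF PQ(1,2)] by blast
    have "AE \<omega> in M. dens M R \<omega> = t * dens M P \<omega> + (1 - t) * dens M Q \<omega>"
      by (rule dens_convex) (use PQ R \<P> in auto)
    then show ?thesis using R(1) by (rule bexI)
  qed
  show "\<exists>Y G. integrable M Y \<and> integrable M G \<and>
      (AE \<omega> in M. \<forall>x. x * Y \<omega> - G \<omega> \<le> dens M P \<omega> * real_of_ereal (f \<omega> x))" if P: "P \<in> \<P>" for P
  proof -
    obtain Y where Y: "Y \<in> L1 M" and ei: "ext_integrable M (\<lambda>\<omega>. max 0 (ftilde f \<omega> (Y \<omega>) (dens M P \<omega>)))"
      using assms(6) P by blast
    \<comment> \<open>This becomes the \<open>G\<close> of \<open>minorant\<close>: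
      \<open>ftilde\<close> is a supremum over \<open>x\<close>, so bounding it by \<open>g\<close>
      bounds the integrand below by an affine function of \<open>x\<close>.\<close>
    define g where "g \<omega> = max 0 (ftilde f \<omega> (Y \<omega>) (dens M P \<omega>))" for \<omega>
    have g[measurable]: "g \<in> borel_measurable M" and gfin: "(\<integral>\<^sup>+\<omega>. e2ennreal (g \<omega>) \<partial>M) < \<infinity>"
      using ei by (auto simp: ext_integrable_def g_def[abs_def])
    have "AE \<omega> in M. e2ennreal (g \<omega>) \<noteq> \<infinity>"
      using gfin by (intro nn_integral_PInf_AE) auto
    then have gr: "AE \<omega> in M. g \<omega> = ereal (real_of_ereal (g \<omega>))"
    proof eventually_elim
      case (elim \<omega>)
      then have "g \<omega> \<noteq> \<infinity>" by (metis e2ennreal_infty infinity_ennreal_def)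
      moreover have "0 \<le> g \<omega>" by (simp add: g_def)
      ultimately show ?case by (cases "g \<omega>") auto
    qed
    have int: "integrable M (\<lambda>\<omega>. real_of_ereal (g \<omega>))"
    proof (rule integrableI_nonneg)
      show "(\<lambda>\<omega>. real_of_ereal (g \<omega>)) \<in> borel_measurable M" by measurable
      show "AE \<omega> in M. 0 \<le> real_of_ereal (g \<omega>)" by (simp add: g_def real_of_ereal_pos)
      have "(\<integral>\<^sup>+\<omega>. ennreal (real_of_ereal (g \<omega>)) \<partial>M) = (\<integral>\<^sup>+\<omega>. e2ennreal (g \<omega>) \<partial>M)"
        using gr by (intro nn_integral_cong_AE) (auto elim!: eventually_mono, metis e2ennreal_ereal)
      then show "(\<integral>\<^sup>+\<omega>. ennreal (real_of_ereal (g \<omega>)) \<partial>M) < \<infinity>" using gfin by simp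
    qed
    have "AE \<omega> in M. \<forall>x. x * Y \<omega> - real_of_ereal (g \<omega>) \<le> dens M P \<omega> * real_of_ereal (f \<omega> x)"
      using gr F(1)
    proof eventually_elim
      case (elim \<omega>)
      show ?case
      proof
        fix x
        have "ereal (x * Y \<omega>) - ereal (dens M P \<omega>) * f \<omega> x \<le> ftilde f \<omega> (Y \<omega>) (dens M P \<omega>)"
          unfolding ftilde_def by (rule SUP_upper) simp
        also have "\<dots> \<le> g \<omega>" by (simp add: g_def)
        finally have "ereal (x * Y \<omega>) - ereal (dens M P \<omega>) * ereal (real_of_ereal (f \<omega> x)) \<le> ereal (real_of_ereal (g \<omega>))"
          using elim by metis
        then show "x * Y \<omega> - real_of_ereal (g \<omega>) \<le> dens M P \<omega> * real_of_ereal (f \<omega> x)" by simp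
      qed
    qed
    then show ?thesis using Y int by (auto simp: L1_def)
  qed
qed

text \<open>As \<open>\<infinity> - \<infinity>\<close> is \<open>\<infinity>\<close>, an
  expectation below \<open>\<infinity>\<close> forces the positive part to be integrable, and this
  is the upper bound that \<open>ZF_integrable\<close> asks for.\<close>

lemma (in robust_integrand) ZF_integrable_ext:
  assumes P: "P \<in> \<P>" and X: "X \<in> Linf M"
    and fin: "ext_expectation M (\<lambda>\<omega>. ereal (Z P \<omega> * F \<omega> (X \<omega>))) < \<infinity>"
  shows "integrable M (\<lambda>\<omega>. Z P \<omega> * F \<omega> (X \<omega>))"
proof -
  let ?w = "\<lambda>\<omega>. Z P \<omega> * F \<omega> (X \<omega>)"
  note [measurable] = F_measurable[OF Linf_D[OF X]] borel_measurable_integrable[OF Z_integrable[OF P]]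
  have e: "e2ennreal (max 0 (ereal x)) = ennreal (max 0 x)" for x
    by (cases "0 \<le> x") (auto simp: max_def e2ennreal_ereal e2ennreal_neg)
  have "(\<integral>\<^sup>+\<omega>. e2ennreal (max 0 (ereal (?w \<omega>))) \<partial>M) \<noteq> \<infinity>"
    using fin by (auto simp: ext_expectation_def)
  then have "(\<integral>\<^sup>+\<omega>. ennreal (max 0 (?w \<omega>)) \<partial>M) < \<infinity>" unfolding e by (simp add: less_top)
  then have "integrable M (\<lambda>\<omega>. max 0 (?w \<omega>))" by (intro integrableI_nonneg) auto
  then show ?thesis by (rule ZF_integrable[OF P X]) auto
qed

section \<open>The two inequalities for the conjugate\<close>

theorem theorem3p9:
  fixes M :: "'a measure" and \<P> :: "'a measure set"
    and f :: "'a \<Rightarrow> real \<Rightarrow> ereal"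
    and \<nu> \<nu>r \<nu>s :: "'a set \<Rightarrow> real"
  assumes "prob_space M" and "complete_measure M"
    and "\<P> \<noteq> {}" and "\<P> \<subseteq> ac_prob_measures M"
    and "convex_measures M \<P>"
    and "compactin (weak_L1 M) (dens M ` \<P>)"
    and "normal_convex_integrand M f"
    and "AE \<omega> in M. \<forall>x. f \<omega> x < \<infinity>"
    and "\<forall>P\<in>\<P>. \<exists>Y\<in>L1 M. ext_integrable M (\<lambda>\<omega>. max 0 (ftilde f \<omega> (Y \<omega>) (dens M P \<omega>)))"
    and "UI_dom M f \<P> \<noteq> {}"
    and "\<nu> \<in> ba M" and "yosida_hewitt M \<nu> \<nu>r \<nu>s"
  shows "J_fun M f \<P> (ba_density M \<nu>r) + (SUP X\<in>UI_dom M f \<P>. ereal (ba_integral M \<nu>s X))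
           \<le> I_conj M f \<P> \<nu>
       \<and> I_conj M f \<P> \<nu>
           \<le> J_fun M f \<P> (ba_density M \<nu>r) + (SUP X\<in>dom_I M f \<P>. ereal (ba_integral M \<nu>s X))"
proof -
  interpret prob_space M by (rule assms(1))
  \<comment> \<open>\<open>real_of_ereal\<close> replaces infinite values by 0; within the space
    this happens on a null set only.\<close>
  define F where "F = (\<lambda>\<omega> x. real_of_ereal (f \<omega> x))"
  have fF: "AE \<omega> in M. \<forall>x. f \<omega> x = ereal (F \<omega> x)"
    unfolding F_def by (rule normal_convex_integrand_real(1)[OF assms(7,8)])
  interpret R: robust_integrand M \<P> "dens M" F
    unfolding F_def using assms(4-9) by (rule robust_integrand_dens)
  have yh: "\<nu>r \<in> ba M" "\<nu>s \<in> ba M" "\<And>A. A \<in> sets M \<Longrightarrow> \<nu> A = \<nu>r A + \<nu>s A"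
    "sigma_additive M \<nu>r" "purely_finitely_additive M \<nu>s"
    using assms(12) by (auto simp: yosida_hewitt_def)
  define Y where "Y = ba_density M \<nu>r"
  have Y: "integrable M Y" unfolding Y_def by (rule ba_density(1)[OF yh(1,4)])
  have nu_split: "ba_integral M \<nu> X = (LINT \<omega>|M. X \<omega> * Y \<omega>) + ba_integral M \<nu>s X" if "X \<in> Linf M" for X
    using ba_integral_split[OF assms(11) yh(1-3) that] ba_integral_eq_LINT[OF yh(1,4) that] by (simp add: Y_def)
  have EP: "ext_expectation P (\<lambda>\<omega>. f \<omega> (X \<omega>)) = ext_expectation M (\<lambda>\<omega>. ereal (dens M P \<omega> * F \<omega> (X \<omega>)))"
    if "P \<in> \<P>" "X \<in> Linf M" for P X
  proof (rule ext_expectation_dens)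
    show "AE \<omega> in M. f \<omega> (X \<omega>) = ereal (F \<omega> (X \<omega>))" using fF by eventually_elim simp
  qed (use that assms(4) in \<open>auto intro: R.F_measurable Linf_D\<close>)
  have env: "ext_expectation M (\<lambda>\<omega>. ftilde f \<omega> (Y \<omega>) (dens M P \<omega>)) =
      ext_expectation M (\<lambda>\<omega>. SUP x. ereal (x * Y \<omega> - dens M P \<omega> * F \<omega> x))" for P
    by (rule ext_expectation_cong_AE, use fF in eventually_elim) (simp add: ftilde_def)
  let ?J = "J_fun M f \<P> (ba_density M \<nu>r)"
  \<comment> \<open>The pointwise Fenchel inequality, integrated for one \<open>P\<close>;
    membership in \<open>dom_I\<close> makes the integrand along \<open>X\<close> integrable.
    Besides the upper bound, this serves to exclude \<open>?J = -\<infinity>\<close>.\<close>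
  have weak: "ereal (LINT \<omega>|M. X \<omega> * Y \<omega>) - I_fun f \<P> X \<le> ?J" if X: "X \<in> dom_I M f \<P>" for X
    unfolding J_fun_def Y_def[symmetric]
  proof (rule INF_greatest)
    fix P assume P: "P \<in> \<P>"
    have XL: "X \<in> Linf M" and fin: "I_fun f \<P> X < \<infinity>" using X by (auto simp: dom_I_def)
    have le: "ext_expectation M (\<lambda>\<omega>. ereal (dens M P \<omega> * F \<omega> (X \<omega>))) \<le> I_fun f \<P> X"
      unfolding I_fun_def EP[OF P XL, symmetric] using P by (rule SUP_upper)
    then have int: "integrable M (\<lambda>\<omega>. dens M P \<omega> * F \<omega> (X \<omega>))"
      using fin by (intro R.ZF_integrable_ext[OF P XL]) auto
    have intY: "integrable M (\<lambda>\<omega>. X \<omega> * Y \<omega>)" using XL Y by (rule Linf_mult_integrable)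
    have "ereal (LINT \<omega>|M. X \<omega> * Y \<omega>) - I_fun f \<P> X \<le>
        ereal (LINT \<omega>|M. X \<omega> * Y \<omega>) - ereal (LINT \<omega>|M. dens M P \<omega> * F \<omega> (X \<omega>))"
      using le unfolding ext_expectation_integrable[OF int] by (intro ereal_minus_mono) auto
    also have "\<dots> = ext_expectation M (\<lambda>\<omega>. ereal (X \<omega> * Y \<omega> - dens M P \<omega> * F \<omega> (X \<omega>)))"
      using int intY by (subst ext_expectation_integrable) auto
    also have "\<dots> \<le> ext_expectation M (\<lambda>\<omega>. SUP x. ereal (x * Y \<omega> - dens M P \<omega> * F \<omega> x))"
      by (intro ext_expectation_mono AE_I2 SUP_upper2[where i="X _"]) auto
    finally show "ereal (LINT \<omega>|M. X \<omega> * Y \<omega>) - I_fun f \<P> X \<le>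
        ext_expectation M (\<lambda>\<omega>. ftilde f \<omega> (Y \<omega>) (dens M P \<omega>))"
      unfolding env .
  qed
  have upper: "I_conj M f \<P> \<nu> \<le> ?J + (SUP X\<in>dom_I M f \<P>. ereal (ba_integral M \<nu>s X))"
    unfolding I_conj_def
  proof (rule SUP_least)
    fix X assume X: "X \<in> Linf M"
    show "ereal (ba_integral M \<nu> X) - I_fun f \<P> X \<le> ?J + (SUP X\<in>dom_I M f \<P>. ereal (ba_integral M \<nu>s X))"
    proof (cases "I_fun f \<P> X < \<infinity>")
      case False
      then show ?thesis by simp
    next
      case True
      then have dom: "X \<in> dom_I M f \<P>" using X by (simp add: dom_I_def)
      have "ereal (ba_integral M \<nu> X) - I_fun f \<P> X =
          (ereal (LINT \<omega>|M. X \<omega> * Y \<omega>) - I_fun f \<P> X) + ereal (ba_integral M \<nu>s X)"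
        unfolding nu_split[OF X] by (cases "I_fun f \<P> X") auto
      also have "\<dots> \<le> ?J + (SUP X\<in>dom_I M f \<P>. ereal (ba_integral M \<nu>s X))"
        using dom by (intro add_mono weak SUP_upper)
      finally show ?thesis .
    qed
  qed
  have UI: "X \<in> Linf M \<and> X \<in> dom_I M f \<P>" if X: "X \<in> UI_dom M f \<P>" for X
  proof -
    have XL: "X \<in> Linf M" using X by (simp add: UI_dom_def)
    have fFX: "AE \<omega> in M. f \<omega> (X \<omega>) = ereal (F \<omega> (X \<omega>))" using fF by eventually_elim simp
    note b = UI_dom_uniform_bounds[where F=F, OF X assms(4) R.F_measurable[OF Linf_D[OF XL]] fFX]
    obtain C where C: "\<And>P. P \<in> \<P> \<Longrightarrow> (LINT \<omega>|M. dens M P \<omega> * max 0 (F \<omega> (X \<omega>))) \<le> C" using b(2) by blast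
    have "I_fun f \<P> X \<le> ereal C"
      unfolding I_fun_def
    proof (rule SUP_least)
      fix P assume P: "P \<in> \<P>"
      have "ext_expectation P (\<lambda>\<omega>. f \<omega> (X \<omega>)) \<le> ext_expectation M (\<lambda>\<omega>. ereal (dens M P \<omega> * max 0 (F \<omega> (X \<omega>))))"
        unfolding EP[OF P XL] by (intro ext_expectation_mono AE_I2) (auto intro!: mult_left_mono R.Z_nonneg)
      also have "\<dots> \<le> ereal C" using C[OF P] by (simp add: ext_expectation_integrable[OF b(1)[OF P]])
      finally show "ext_expectation P (\<lambda>\<omega>. f \<omega> (X \<omega>)) \<le> ereal C" .
    qed
    then have "I_fun f \<P> X < \<infinity>" by (rule order_le_less_trans) simp
    then show ?thesis using XL by (simp add: dom_I_def)
  qed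
  obtain N where N: "incseq N" "range N \<subseteq> sets M" "AE \<omega> in M. \<exists>n. \<omega> \<in> N n"
    "\<And>n B. B \<in> sets M \<Longrightarrow> B \<subseteq> N n \<Longrightarrow> \<nu>s B = 0"
    using purely_finitely_additive_carrier[OF yh(2,5)] by metis
  have singular: "?J + ereal (ba_integral M \<nu>s X0) \<le> I_conj M f \<P> \<nu>" if X0: "X0 \<in> UI_dom M f \<P>" for X0
  proof -
    have X0L: "X0 \<in> Linf M" using UI[OF X0] by simp
    note [measurable] = R.F_measurable[OF Linf_D[OF X0L]]
    have fFX0: "AE \<omega> in M. f \<omega> (X0 \<omega>) = ereal (F \<omega> (X0 \<omega>))" using fF by eventually_elim simp
    note b = UI_dom_uniform_bounds[where F=F, OF X0 assms(4) R.F_measurable[OF Linf_D[OF X0L]] fFX0]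
    \<comment> \<open>The first factor makes \<open>\<nu>s\<close> vanish on measurable subsets of
      \<open>A n\<close>, the second bounds \<open>F\<close> along \<open>X0\<close>. As
      \<open>F\<close> is real-valued, the intersections still cover almost all of the
      space.\<close>
    define A where "A n = N n \<inter> {\<omega> \<in> space M. F \<omega> (X0 \<omega>) \<le> real n}" for n
    interpret D: robust_duality M \<P> "dens M" F X0 Y A
    proof
      show "A n \<in> sets M" for n unfolding A_def using N(2) by (intro sets.Int) auto
      show "incseq A"
      proof (rule incseq_SucI)
        show "A n \<subseteq> A (Suc n)" for n using incseq_SucD[OF N(1), of n] by (auto simp: A_def)
      qed
      show "AE \<omega> in M. \<exists>n. \<omega> \<in> A n"
        using N(3) AE_space
      proof eventually_elim
        case (elim \<omega>)
        then obtain n where n: "\<omega> \<in> N n" by blast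
        obtain k :: nat where "F \<omega> (X0 \<omega>) \<le> real k" using real_arch_simple by blast
        then have "F \<omega> (X0 \<omega>) \<le> real (max n k)" by (simp add: le_max_iff_disj)
        then show ?case using incseqD[OF N(1), of n "max n k"] n elim(2) by (auto simp: A_def intro!: exI[of _ "max n k"])
      qed
    qed (use X0L Y b in \<open>auto simp: A_def\<close>)
    have "?J \<le> I_conj M f \<P> \<nu> - ereal (ba_integral M \<nu>s X0)"
    proof (rule dense_le)
      fix y assume "y < ?J"
      \<comment> \<open>For each \<open>P\<close> some competitor exceeds \<open>c\<close>, and the
        minimax theorem keeps \<open>d < c\<close> for one competitor common to all
        \<open>P\<close>. Working with arbitrary \<open>y\<close> includes the case that
        \<open>?J\<close> is infinite.\<close>
      then obtain d where d: "y < ereal d" "ereal d < ?J" using ereal_dense2 by blast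
      then obtain c where c: "ereal d < ereal c" "ereal c < ?J" using ereal_dense2 by blast
      have "\<exists>X\<in>D.competitors. c < D.gap P X" if P: "P \<in> \<P>" for P
      proof (rule ccontr)
        assume "\<not> ?thesis"
        then have "ext_expectation M (\<lambda>\<omega>. ftilde f \<omega> (Y \<omega>) (dens M P \<omega>)) \<le> ereal c"
          unfolding env using D.ext_expectation_envelope_le[OF P] by (force simp: D.integrand_def not_less)
        moreover have "?J \<le> ext_expectation M (\<lambda>\<omega>. ftilde f \<omega> (Y \<omega>) (dens M P \<omega>))"
          unfolding J_fun_def Y_def using P by (rule INF_lower)
        ultimately show False using c(2) by (meson leD order_trans)
      qed
      then obtain X where X: "X \<in> D.competitors" "\<forall>P\<in>\<P>. d \<le> D.gap P X"
        using D.gap_minimax[of c d] c(1) by auto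
      have XL: "X \<in> Linf M" by (rule D.competitors_Linf[OF X(1)])
      obtain n where n: "\<forall>\<omega>\<in>space M - A n. X \<omega> = X0 \<omega>" using X(1) by (auto simp: D.competitors_def)
      have "ba_integral M \<nu>s X = ba_integral M \<nu>s X0"
      proof (rule ba_integral_cong_carrier[OF yh(2) XL X0L D.A_sets])
        show "\<nu>s B = 0" if "B \<in> sets M" "B \<subseteq> A n" for B using N(4)[of B n] that by (auto simp: A_def)
      qed (use n in auto)
      then have nuX: "ba_integral M \<nu> X = (LINT \<omega>|M. X \<omega> * Y \<omega>) + ba_integral M \<nu>s X0"
        using nu_split[OF XL] by simp
      have I: "I_fun f \<P> X \<le> ereal ((LINT \<omega>|M. X \<omega> * Y \<omega>) - d)"
        unfolding I_fun_def
      proof (rule SUP_least)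
        fix P assume P: "P \<in> \<P>"
        show "ext_expectation P (\<lambda>\<omega>. f \<omega> (X \<omega>)) \<le> ereal ((LINT \<omega>|M. X \<omega> * Y \<omega>) - d)"
          unfolding EP[OF P XL] ext_expectation_integrable[OF D.competitor_integrable[OF P X(1)]]
          using X(2) P by (force simp: D.gap_def)
      qed
      have "ereal (d + ba_integral M \<nu>s X0) = ereal (ba_integral M \<nu> X) - ereal ((LINT \<omega>|M. X \<omega> * Y \<omega>) - d)"
        by (simp add: nuX)
      also have "\<dots> \<le> ereal (ba_integral M \<nu> X) - I_fun f \<P> X" using I by (intro ereal_minus_mono) auto
      also have "\<dots> \<le> I_conj M f \<P> \<nu>" unfolding I_conj_def using XL by (rule SUP_upper)
      finally have "ereal d \<le> I_conj M f \<P> \<nu> - ereal (ba_integral M \<nu>s X0)"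
        by (cases "I_conj M f \<P> \<nu>") auto
      then show "y \<le> I_conj M f \<P> \<nu> - ereal (ba_integral M \<nu>s X0)" using d(1) by simp
    qed
    then show ?thesis by (cases ?J; cases "I_conj M f \<P> \<nu>") auto
  qed
  \<comment> \<open>In \<open>ereal\<close> the sum of \<open>-\<infinity>\<close> and
    \<open>\<infinity>\<close> is \<open>\<infinity>\<close>, so with
    \<open>?J = -\<infinity>\<close> and an infinite supremum over \<open>UI_dom\<close> addition
    would not commute with the supremum.\<close>
  have "?J \<noteq> -\<infinity>"
  proof -
    obtain X0 where "X0 \<in> UI_dom M f \<P>" using assms(10) by blast
    then have "X0 \<in> dom_I M f \<P>" using UI by blast
    with weak[OF this] show ?thesis by (cases "I_fun f \<P> X0") (auto simp: dom_I_def)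
  qed
  then have "?J + (SUP X\<in>UI_dom M f \<P>. ereal (ba_integral M \<nu>s X)) =
      (SUP X\<in>UI_dom M f \<P>. ?J + ereal (ba_integral M \<nu>s X))"
    using assms(10) by (intro SUP_ereal_add_right[symmetric])
  also have "\<dots> \<le> I_conj M f \<P> \<nu>" using singular by (rule SUP_least)
  finally show ?thesis using upper by blast
qed

end
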